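(* Let $K\geq3$, $d\geq4K+4$, and let $\Delta=\{v_0,\ldots,v_{K-1}\}\subseteq\mathbb{Z}^d$ be the vertex set of a fixed nondegenerate $(K-1)$-simplex. There is a constant $C_{\Delta,d}>0$, depending only on $\Delta$ and $d$, such that for every $\alpha>0$ and every measurable $E\subseteq[0,1]^d$ with Lebesgue measure $|E|\geq\alpha$, there are $x\in\mathbb{R}^d$, $U\in\mathrm{O}(d)$, and \[ \lambda\geq\exp\left(-C_{\Delta,d}\bigl(1+\log(1/\alpha)\bigr)^2\right) \] such that $x+\lambda U\Delta\subseteq E$.
   Context: The set $\{v_0,\ldots,v_{K-1}\}$ is the vertex set of a nondegenerate $(K-1)$-simplex if these $K$ points are affinely independent. $\mathrm{O}(d)$ is the real orthogonal group, and $x+\lambda U\Delta=\{x+\lambda Uv_i:0\leq i\leq K-1\}$. *)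

theory Defs
  imports "HOL-Analysis.Analysis"
begin

definition integer_points :: "(real ^ 'n) set" where
  "integer_points = {v. \<forall>i. v $ i \<in> \<int>}"

definition unit_cube :: "(real ^ 'n) set" where
  "unit_cube = {x. \<forall>i. 0 \<le> x $ i \<and> x $ i \<le> 1}"

(* Requiring exactly K elements makes the points v_0, ..., v_{K-1} pairwise distinct, which
   affine_dependent, being a predicate on sets, cannot express for an indexed family. *)
definition nondegenerate_simplex_vertices :: "nat \<Rightarrow> (real ^ 'n) set \<Rightarrow> bool" where
  "nondegenerate_simplex_vertices K \<Delta> \<longleftrightarrow>
     finite \<Delta> \<and> card \<Delta> = K \<and> \<not> affine_dependent \<Delta>"

definition similar_copy ::
  "real ^ 'n \<Rightarrow> real \<Rightarrow> real ^ 'n ^ 'n \<Rightarrow> (real ^ 'n) set \<Rightarrow> (real ^ 'n) set" where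
  "similar_copy x r U \<Delta> = (\<lambda>v. x + r *\<^sub>R (U *v v)) ` \<Delta>"

end

(* Density increment. Fix the density alpha and put delta = c alpha^(4K). If E has density beta >= alpha
   in the unit cube and no cube of side delta has density above (1 + eta) beta, then E contains a
   similar copy of the simplex at a scale bounded below independently of alpha; otherwise rescale
   such a cube. The density grows by a constant factor each time, so there are O(1 + log(1/alpha))
   steps, each costing a factor delta in the scale.

   In the first case let g be the average of 1_E over cubes of side delta. As g <= (1 + eta) beta and g
   has mean beta, g is close to beta in L^1, so the average of prod_i g(x + lambda U v_i) is at least
   beta^K / 2. Replacing g by 1_E one vertex at a time costs little: rotations fixing all vertices but
   one move that vertex to many separated positions, and after Cauchy-Schwarz only correlations
   of 1_E - g with its averages over spherical shells remain, which are small since 1_E - g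
   has mean zero at scale delta.

   No Haar measure is needed: U is drawn from Lebesgue measure on matrices that are isometries up to
   a factor 1 + e, a set invariant under right multiplication by orthogonal matrices. For compact E
   letting e tend to 0 turns near copies into exact ones. *)

theory Submission
  imports Defs
begin

section \<open>Lebesgue measure and orthogonal transformations\<close>

text \<open>The exponent 4K comes from balancing errors. Each of the K replacements may cost
  \<theta> = \<eta> \<alpha>^K relative to the total mass. Squaring an average over M rotations
  leaves a diagonal of relative size 1 / M, so M is of order \<theta>^-2. The M positions are only
  about 1 / M apart, which makes the off-diagonal correlations of order \<delta> M. Both
  contributions must be below \<theta>^2, hence \<delta> is of order \<theta>^4. The squared
  logarithm is the number of steps times log(1/\<delta>).

  The measure of the near-isometries tends to 0 with e. Every error is therefore a multiple of the
  total mass with a factor free of e; only so can \<delta> be fixed before e.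

  Spheres have no volume, which obstructs comparing shell averages with cube averages. The random
  dilation repairs this: the displacement between two points can be rotated onto a multiple of an
  auxiliary vector a whose norm is the dilation, and averaging over a fills a solid shell. A
  Lipschitz weight on that shell yields the gain \<delta> / s at distance s.\<close>

lemma nn_integral_lborel_translation:
  fixes f :: "'a::euclidean_space \<Rightarrow> ennreal"
  assumes [measurable]: "f \<in> borel_measurable borel"
  shows "(\<integral>\<^sup>+x. f (x + c) \<partial>lborel) = (\<integral>\<^sup>+x. f x \<partial>lborel)"
  by (subst (2) lborel_distr_plus[of c, symmetric], subst nn_integral_distr) (auto simp: add.commute)

lemma integral_lborel_translation:
  fixes f :: "'a::euclidean_space \<Rightarrow> real"
  assumes [measurable]: "f \<in> borel_measurable borel"
  shows "(\<integral>x. f (x + c) \<partial>lborel) = (\<integral>x. f x \<partial>lborel)"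
  by (subst (2) lborel_distr_plus[of c, symmetric], subst integral_distr) (auto simp: add.commute)

text \<open>The library has this only for \<open>real ^ 'n\<close> with well-ordered \<open>'n\<close>, which does not cover matrices.
  Translation invariance alone suffices: integrate \<open>1\<^sub>S (f x) 1\<^sub>B (f x - y)\<close> over \<open>x\<close> and \<open>y\<close> in both orders.\<close>

lemma lborel_distr_orthogonal_transformation:
  fixes f :: "'a::euclidean_space \<Rightarrow> 'a"
  assumes f: "orthogonal_transformation f"
  shows "distr lborel borel f = lborel"
proof (rule measure_eqI)
  have lin: "linear f" and nf: "\<And>x. norm (f x) = norm x"
    using f orthogonal_transformation by auto
  have f_meas [measurable]: "f \<in> borel_measurable borel"
    by (intro borel_measurable_continuous_onI linear_continuous_on linear_conv_bounded_linear[THEN iffD1] lin)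
  fix S assume "S \<in> sets (distr lborel borel f)"
  then have [measurable]: "S \<in> sets borel" by simp
  define B :: "'a set" where "B = ball 0 1"
  have [measurable]: "B \<in> sets borel" by (simp add: B_def)
  let ?F = "\<lambda>x y. indicator S (f x) * indicator B (f x - y) :: ennreal"
  have "(\<integral>\<^sup>+y. \<integral>\<^sup>+x. ?F x y \<partial>lborel \<partial>lborel) = (\<integral>\<^sup>+y. \<integral>\<^sup>+x. indicator S (f x + y) * indicator B x \<partial>lborel \<partial>lborel)"
  proof (rule nn_integral_cong)
    fix y
    \<comment> \<open>Shifting \<open>x\<close> by \<open>z\<close> turns \<open>f x - y\<close>
      into \<open>f x\<close>, and \<open>f x\<close> lies in the unit ball exactly when
      \<open>x\<close> does: this is where norm preservation enters.\<close>
    obtain z where z: "f z = y" using orthogonal_transformation_surj[OF f] by (metis surjD)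
    have "(\<integral>\<^sup>+x. ?F x y \<partial>lborel) = (\<integral>\<^sup>+x. ?F (x + z) y \<partial>lborel)"
      by (rule nn_integral_lborel_translation[of "\<lambda>x. ?F x y", symmetric]) simp
    also have "\<dots> = (\<integral>\<^sup>+x. indicator S (f x + y) * indicator B x \<partial>lborel)"
      by (intro nn_integral_cong) (simp add: linear_add[OF lin] z indicator_def nf B_def)
    finally show "(\<integral>\<^sup>+x. ?F x y \<partial>lborel) = \<dots>" .
  qed
  also have "\<dots> = (\<integral>\<^sup>+x. \<integral>\<^sup>+y. indicator S (f x + y) * indicator B x \<partial>lborel \<partial>lborel)"
    by (rule lborel_pair.Fubini') simp
  also have "\<dots> = (\<integral>\<^sup>+x. emeasure lborel S * indicator B x \<partial>lborel)"
  proof (rule nn_integral_cong)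
    fix x
    show "(\<integral>\<^sup>+y. indicator S (f x + y) * indicator B x \<partial>lborel) = emeasure lborel S * indicator B x"
      using nn_integral_lborel_translation[of "indicator S" "f x"]
      by (simp add: nn_integral_multc add.commute)
  qed
  also have "\<dots> = emeasure lborel S * emeasure lborel B"
    by (simp add: nn_integral_cmult)
  finally have 1: "(\<integral>\<^sup>+y. \<integral>\<^sup>+x. ?F x y \<partial>lborel \<partial>lborel) = emeasure lborel S * emeasure lborel B" .
  have "(\<integral>\<^sup>+y. \<integral>\<^sup>+x. ?F x y \<partial>lborel \<partial>lborel) = (\<integral>\<^sup>+x. \<integral>\<^sup>+y. ?F x y \<partial>lborel \<partial>lborel)"
    by (rule lborel_pair.Fubini') simp
  also have "\<dots> = (\<integral>\<^sup>+x. indicator S (f x) * emeasure lborel B \<partial>lborel)"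
  proof (rule nn_integral_cong)
    fix x
    have "(\<integral>\<^sup>+y. indicator B (f x - y) \<partial>lborel) = (\<integral>\<^sup>+y. indicator B (y + (- f x)) \<partial>(lborel :: 'a measure))"
      by (intro nn_integral_cong) (simp add: indicator_def norm_minus_commute B_def)
    also have "\<dots> = emeasure lborel B"
      by (subst nn_integral_lborel_translation) auto
    finally show "(\<integral>\<^sup>+y. ?F x y \<partial>lborel) = indicator S (f x) * emeasure lborel B"
      by (simp add: nn_integral_cmult)
  qed
  also have "\<dots> = (\<integral>\<^sup>+x. indicator (f -` S) x * emeasure lborel B \<partial>lborel)"
    by (intro nn_integral_cong) (simp add: indicator_def)
  also have "\<dots> = emeasure lborel (f -` S) * emeasure lborel B"
    using measurable_sets_borel[of f borel S] by (subst nn_integral_multc) auto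
  finally have "emeasure lborel (f -` S) * emeasure lborel B = emeasure lborel S * emeasure lborel B"
    using 1 by simp
  moreover have "emeasure lborel B \<noteq> 0"
    unfolding B_def using open_not_negligible[of "ball 0 1 :: 'a set"] by (auto simp: negligible_iff_null_sets null_sets_def completion.null_sets_outer)
  moreover have "emeasure lborel B \<noteq> \<infinity>"
    using emeasure_bounded_finite[of B] by (auto simp: B_def)
  ultimately have "emeasure lborel (f -` S) = emeasure lborel S"
    by (auto simp: ennreal_mult_cancel_left mult.commute[of _ "emeasure lborel B"])
  then show "emeasure (distr lborel borel f) S = emeasure lborel S"
    by (simp add: emeasure_distr)
qed simp

section \<open>Right multiplication by orthogonal matrices\<close>

lemma orthogonal_transformation_matrix_mult_right:
  fixes R :: "real^'n^'n"
  assumes "orthogonal_matrix R"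
  shows "orthogonal_transformation (\<lambda>A::real^'n^'m. A ** R)"
proof -
  \<comment> \<open>Right multiplication acts on each row by the transpose of \<open>R\<close>, and
    the inner product of matrices is the sum of the inner products of their rows.\<close>
  have row: "(A ** R) $ i = transpose R *v (A $ i)" for A :: "real^'n^'m" and i
    by (simp add: vec_eq_iff matrix_matrix_mult_def matrix_vector_mult_def transpose_def mult.commute)
  have "orthogonal_transformation ((*v) (transpose R))"
    using assms by (simp add: orthogonal_transformation_matrix orthogonal_matrix_transpose)
  then have "(transpose R *v x) \<bullet> (transpose R *v y) = x \<bullet> y" for x y
    by (simp add: orthogonal_transformation_def)
  then have "(A ** R) \<bullet> (B ** R) = A \<bullet> B" for A B :: "real^'n^'m"
    by (simp add: inner_vec_def[of "A ** R"] inner_vec_def[of A] row)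
  moreover have "linear (\<lambda>A::real^'n^'m. A ** R)"
    by (intro linearI) (simp_all add: matrix_matrix_mult_def vec_eq_iff algebra_simps sum.distrib sum_distrib_left)
  ultimately show ?thesis by (simp add: orthogonal_transformation_def)
qed

text \<open>Stands in for right invariance of Haar measure on the orthogonal group.\<close>

lemma integral_lborel_matrix_mult_right:
  fixes R :: "real^'n^'n" and \<phi> :: "real^'n^'m \<Rightarrow> real"
  assumes R: "orthogonal_matrix R" and [measurable]: "\<phi> \<in> borel_measurable borel"
  shows "(\<integral>A. \<phi> (A ** R) \<partial>lborel) = (\<integral>A. \<phi> A \<partial>lborel)"
proof -
  have o: "orthogonal_transformation (\<lambda>A::real^'n^'m. A ** R)"
    by (rule orthogonal_transformation_matrix_mult_right[OF R])
  have [measurable]: "(\<lambda>A::real^'n^'m. A ** R) \<in> borel_measurable borel"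
    by (intro borel_measurable_continuous_onI linear_continuous_on linear_conv_bounded_linear[THEN iffD1]
        orthogonal_transformation_linear o)
  show ?thesis
    by (subst (2) lborel_distr_orthogonal_transformation[OF o, symmetric], subst integral_distr) auto
qed

lemma bounded_bilinear_matrix_vector_mult:
  "bounded_bilinear ((*v) :: real^'n^'m \<Rightarrow> real^'n \<Rightarrow> real^'m)"
  by (intro bilinear_conv_bounded_bilinear[THEN iffD1])
     (auto simp: bilinear_def intro!: linearI
        simp: matrix_vector_mult_add_rdistrib matrix_vector_mult_def vec_eq_iff algebra_simps
          sum.distrib sum_distrib_left)

lemma continuous_on_matrix_vector_mult' [continuous_intros]:
  fixes A :: "'b::topological_space \<Rightarrow> real^'n^'m"
  assumes "continuous_on S A" "continuous_on S v"
  shows "continuous_on S (\<lambda>z. A z *v v z)"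
  using bounded_bilinear.continuous_on[OF bounded_bilinear_matrix_vector_mult assms] .

lemma borel_measurable_matrix_vector_mult [measurable (raw)]:
  fixes A :: "'b \<Rightarrow> real^'n^'m"
  assumes [measurable]: "A \<in> borel_measurable M" "v \<in> borel_measurable M"
  shows "(\<lambda>z. A z *v v z) \<in> borel_measurable M"
proof -
  have "(\<lambda>p :: (real^'n^'m) \<times> (real^'n). fst p *v snd p) \<in> borel_measurable borel"
    by (intro borel_measurable_continuous_onI continuous_intros)
  from measurable_compose[OF _ this, of "\<lambda>z. (A z, v z)" M] show ?thesis by simp
qed

section \<open>Averages over near-isometric configurations\<close>

lemma integrable_lborel_bounded_support:
  fixes f :: "'a::euclidean_space \<Rightarrow> real"
  assumes "f \<in> borel_measurable borel" and B: "\<And>z. \<bar>f z\<bar> \<le> B" and r: "\<And>z. f z \<noteq> 0 \<Longrightarrow> norm z \<le> r"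
  shows "integrable lborel f"
  using assms emeasure_bounded_finite[of "cball (0::'a) r"]
  by (intro integrableI_bounded_set[where A="cball 0 r" and B=B]) fastforce+

lemma lborel_integral_fst:
  fixes f :: "'a::euclidean_space \<times> 'b::euclidean_space \<Rightarrow> real"
  assumes "integrable lborel f"
  shows "(\<integral>z. f z \<partial>lborel) = (\<integral>x. \<integral>y. f (x, y) \<partial>lborel \<partial>lborel)"
  using lborel_pair.integral_fst'[of f] assms by (simp add: lborel_prod)

lemma lborel_integral_snd:
  fixes f :: "'a::euclidean_space \<times> 'b::euclidean_space \<Rightarrow> real"
  assumes "integrable lborel f"
  shows "(\<integral>z. f z \<partial>lborel) = (\<integral>y. \<integral>x. f (x, y) \<partial>lborel \<partial>lborel)"
  using lborel_pair.integral_snd[of "\<lambda>x y. f (x, y)"] assms by (simp add: lborel_prod)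

section \<open>Approximate isometries and the radial weight\<close>

definition near_iso :: "real \<Rightarrow> (real^'n^'n) set" where
  "near_iso e = {A. \<forall>x. \<bar>norm (A *v x) - norm x\<bar> \<le> e * norm x}"

text \<open>A radial tent. It vanishes outside the shell between radii 1 and 2, so that dilation
  factors stay comparable to 1, and it is Lipschitz rather than an indicator because it is compared
  with small translates of itself.\<close>

definition bump :: "'a::real_normed_vector \<Rightarrow> real" where
  "bump a = max 0 (1 - 2 * \<bar>norm a - 3 / 2\<bar>)"

lemma bump_nonneg: "0 \<le> bump a" and bump_le_1: "bump a \<le> 1"
  by (auto simp: bump_def)

lemma bump_support: "bump a \<noteq> 0 \<Longrightarrow> 1 < norm a \<and> norm a < 2"
  by (auto simp: bump_def abs_if max_def split: if_splits)

lemma bump_lipschitz: "\<bar>bump a - bump b\<bar> \<le> 2 * norm (a - b)"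
  using norm_triangle_ineq3[of a b] by (auto simp: bump_def max_def abs_if split: if_splits)

lemma borel_measurable_bump [measurable]: "bump \<in> borel_measurable borel"
  unfolding bump_def by measurable

lemma integrable_bump: "integrable lborel (bump :: 'a::euclidean_space \<Rightarrow> real)"
  by (rule integrable_lborel_bounded_support[where B=1 and r=2])
     (auto simp: bump_nonneg bump_le_1 dest!: bump_support)

lemma integral_bump_pos: "0 < (\<integral>a. bump a \<partial>(lborel :: 'a::euclidean_space measure))"
proof -
  obtain b :: 'a where b: "b \<in> Basis" using nonempty_Basis by blast
  let ?c = "(3/2) *\<^sub>R b :: 'a" and ?U = "ball ((3/2) *\<^sub>R b) (1/4) :: 'a set"
  have fin: "emeasure lborel ?U < \<infinity>"
    by (rule emeasure_bounded_finite) simp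
  have "0 < (1/2) * measure lborel ?U"
    using content_ball_pos[of "1/4" ?c] by simp
  also have "\<dots> = (\<integral>a. (1/2) * indicator ?U a \<partial>lborel)"
    using fin by simp
  also have "\<dots> \<le> (\<integral>a. bump a \<partial>(lborel :: 'a measure))"
  proof (rule integral_mono)
    show "integrable lborel (\<lambda>x. 1/2 * indicator ?U x :: real)"
      using fin by (intro integrable_mult_right integrable_real_indicator) auto
  next
    fix x :: 'a
    show "1/2 * indicator ?U x \<le> bump x"
    proof (cases "x \<in> ?U")
      case True
      then have "norm (?c - x) < 1/4" by (simp add: dist_norm)
      moreover have "norm ?c = 3/2" using b by simp
      ultimately have "\<bar>norm x - 3/2\<bar> \<le> 1/4"
        using norm_triangle_ineq3[of ?c x] by linarith
      then show ?thesis using True by (simp add: bump_def)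
    qed (simp add: bump_nonneg)
  qed (rule integrable_bump)
  finally show ?thesis .
qed

lemma closed_near_iso: "closed (near_iso e :: (real^'n^'n) set)"
  unfolding near_iso_def Collect_all_eq
  by (intro closed_INT ballI closed_Collect_le continuous_intros)

lemma near_iso_sets [measurable]: "near_iso e \<in> sets borel"
  by (simp add: closed_near_iso)

lemma norm_near_iso:
  assumes "A \<in> near_iso e"
  shows "norm (A *v x) \<le> (1 + e) * norm x" "(1 - e) * norm x \<le> norm (A *v x)"
  using assms[unfolded near_iso_def] by (auto simp: algebra_simps abs_le_iff dest!: spec[of _ x])

lemma near_iso_bounded:
  fixes A :: "real^'n^'n"
  assumes A: "A \<in> near_iso e"
  shows "norm A \<le> (1 + e) * real CARD('n) * real CARD('n)"
proof -
  have "norm A \<le> (\<Sum>i\<in>UNIV. norm (A $ i))" unfolding norm_vec_def by (rule L2_set_le_sum) simp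
  also have "\<dots> \<le> (\<Sum>i\<in>(UNIV::'n set). \<Sum>j\<in>(UNIV::'n set). (1 + e))"
  proof (rule sum_mono)
    fix i
    have "\<bar>A $ i $ j\<bar> \<le> 1 + e" for j
    proof -
      have "\<bar>A $ i $ j\<bar> = \<bar>(A *v axis j 1) $ i\<bar>" by (simp add: matrix_vector_mul_component inner_axis)
      also have "\<dots> \<le> norm (A *v axis j 1)" by (rule component_le_norm_cart)
      also have "\<dots> \<le> 1 + e" using norm_near_iso(1)[OF A, of "axis j 1"] by simp
      finally show ?thesis .
    qed
    then show "norm (A $ i) \<le> (\<Sum>j\<in>(UNIV::'n set). (1 + e))"
      by (intro order_trans[OF norm_le_l1_cart] sum_mono) auto
  qed
  finally show ?thesis by (simp add: algebra_simps)
qed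

lemma near_iso_emeasure_finite: "emeasure lborel (near_iso e :: (real^'n^'n) set) < \<infinity>"
  by (rule emeasure_bounded_finite) (auto simp: bounded_iff intro: near_iso_bounded)

text \<open>The orthogonal matrices form a null set, but for positive \<open>e\<close> a ball around
  the identity fits inside: \<open>norm (A *v x)\<close> differs from \<open>norm x\<close> by at
  most \<open>norm ((A - mat 1) *v x)\<close>.\<close>

lemma near_iso_measure_pos:
  assumes "0 < e"
  shows "0 < measure lborel (near_iso e :: (real^'n^'n) set)"
proof -
  obtain C where C: "C > 0" "\<And>(A::real^'n^'n) x. norm (A *v x) \<le> norm A * norm x * C"
    using bounded_bilinear.pos_bounded[OF bounded_bilinear_matrix_vector_mult] by blast
  have sub: "ball (mat 1) (e / C) \<subseteq> (near_iso e :: (real^'n^'n) set)"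
  proof
    fix A :: "real^'n^'n" assume "A \<in> ball (mat 1) (e / C)"
    then have "norm (A - mat 1) * C \<le> e" using C by (simp add: dist_norm norm_minus_commute field_simps)
    moreover have "\<bar>norm (A *v x) - norm x\<bar> \<le> norm (A - mat 1) * C * norm x" for x
    proof -
      have "\<bar>norm (A *v x) - norm x\<bar> \<le> norm (A *v x - x)" by (rule norm_triangle_ineq3)
      also have "A *v x - x = (A - mat 1) *v x" by (simp add: matrix_vector_mult_diff_rdistrib)
      also have "norm \<dots> \<le> norm (A - mat 1) * C * norm x" using C(2)[of "A - mat 1" x] by (simp add: mult_ac)
      finally show ?thesis .
    qed
    ultimately show "A \<in> near_iso e" unfolding near_iso_def
      by (blast intro: order_trans mult_right_mono norm_ge_zero)
  qed
  have "0 < measure lborel (ball (mat 1) (e / C) :: (real^'n^'n) set)"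
    using content_ball_pos[of "e / C" "mat 1 :: real^'n^'n"] assms C by simp
  also have "\<dots> \<le> measure lborel (near_iso e :: (real^'n^'n) set)"
    using sub near_iso_emeasure_finite by (intro measure_mono_fmeasurable) (auto simp: fmeasurable_def)
  finally show ?thesis .
qed

text \<open>\<open>R\<close> preserves norms and is onto, so the condition may be tested on the
  vectors \<open>R *v x\<close> instead of \<open>x\<close>.\<close>

lemma near_iso_mult_right:
  assumes R: "orthogonal_matrix R"
  shows "A ** R \<in> near_iso e \<longleftrightarrow> A \<in> near_iso e"
proof -
  have ot: "orthogonal_transformation ((*v) R)" using R by (simp add: orthogonal_transformation_matrix)
  have *: "norm (R *v x) = norm x" for x using ot orthogonal_transformation by auto
  have s: "\<exists>y. R *v y = x" for x using orthogonal_transformation_surj[OF ot] by (metis surjD)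
  show ?thesis unfolding near_iso_def matrix_vector_mul_assoc[symmetric] mem_Collect_eq
    using * s by metis
qed

section \<open>Integrals over configurations\<close>

text \<open>The norm of \<open>a\<close> is the dilation factor of the configuration and \<open>A\<close> its approximate rotation. The whole
  vector \<open>a\<close> is kept because \<open>norm a *\<^sub>R A *v u\<close> (\<open>u\<close> a unit vector) has the same distribution as \<open>A *v a\<close>,
  which is spread over a full-dimensional shell.\<close>

definition config_int :: "real \<Rightarrow> (real^'n \<Rightarrow> real^'n^'n \<Rightarrow> real^'n \<Rightarrow> real) \<Rightarrow> real" where
  "config_int e \<Phi> = (\<integral>(a, A, x). bump a * indicator (near_iso e) A * \<Phi> a A x \<partial>lborel)"

text \<open>What makes the weighted integrand integrable on the product and on its slices. The
  support in \<open>x\<close> is required to be bounded only where the weight lives, since the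
  shifts of \<open>x\<close> by vertices are bounded only there.\<close>

definition admissible :: "real \<Rightarrow> (real^'n \<Rightarrow> real^'n^'n \<Rightarrow> real^'n \<Rightarrow> real) \<Rightarrow> bool" where
  "admissible e \<Phi> \<longleftrightarrow> (\<lambda>(a, A, x). \<Phi> a A x) \<in> borel_measurable borel \<and>
     (\<exists>B. \<forall>a A x. \<bar>\<Phi> a A x\<bar> \<le> B) \<and>
     (\<exists>r. \<forall>a A x. norm a \<le> 2 \<longrightarrow> A \<in> near_iso e \<longrightarrow> \<Phi> a A x \<noteq> 0 \<longrightarrow> norm x \<le> r)"

lemma admissible_measurable:
  assumes "admissible e \<Phi>" "f \<in> borel_measurable M" "g \<in> borel_measurable M" "h \<in> borel_measurable M"
  shows "(\<lambda>z. \<Phi> (f z) (g z) (h z)) \<in> borel_measurable M"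
  using measurable_compose[of "\<lambda>z. (f z, g z, h z)" M borel "\<lambda>(a, A, x). \<Phi> a A x" borel] assms
  unfolding admissible_def by simp

lemma borel_measurable_projs:
  "fst \<in> borel_measurable (borel :: ('a::second_countable_topology \<times> 'b::second_countable_topology) measure)"
  "(\<lambda>z. fst (snd z)) \<in> borel_measurable (borel :: ('a \<times> 'b \<times> 'c::second_countable_topology) measure)"
  "(\<lambda>z. snd (snd z)) \<in> borel_measurable (borel :: ('a \<times> 'b \<times> 'c) measure)"
  by (intro borel_measurable_continuous_onI continuous_intros)+

lemma admissible_cmult: "admissible e \<Phi> \<Longrightarrow> admissible e (\<lambda>a A x. c * \<Phi> a A x)"
proof -
  assume *: "admissible e \<Phi>"
  then obtain B where "\<And>a A x. \<bar>\<Phi> a A x\<bar> \<le> B" unfolding admissible_def by blast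
  then have "\<bar>c * \<Phi> a A x\<bar> \<le> \<bar>c\<bar> * B" for a A x by (auto simp: abs_mult intro: mult_left_mono)
  moreover have "(\<lambda>(a, A, x). c * \<Phi> a A x) \<in> borel_measurable borel"
    unfolding case_prod_beta by (intro borel_measurable_times borel_measurable_const admissible_measurable[OF *] borel_measurable_projs)
  ultimately show ?thesis using * unfolding admissible_def by (auto, blast)
qed

lemma admissible_add:
  assumes *: "admissible e \<Phi>" and **: "admissible e \<Psi>"
  shows "admissible e (\<lambda>a A x. \<Phi> a A x + \<Psi> a A x)"
proof -
  obtain B r where 1: "\<And>a A x. \<bar>\<Phi> a A x\<bar> \<le> B"
    "\<And>a A x. norm a \<le> 2 \<Longrightarrow> A \<in> near_iso e \<Longrightarrow> \<Phi> a A x \<noteq> 0 \<Longrightarrow> norm x \<le> r"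
    using * unfolding admissible_def by blast
  obtain B' r' where 2: "\<And>a A x. \<bar>\<Psi> a A x\<bar> \<le> B'"
    "\<And>a A x. norm a \<le> 2 \<Longrightarrow> A \<in> near_iso e \<Longrightarrow> \<Psi> a A x \<noteq> 0 \<Longrightarrow> norm x \<le> r'"
    using ** unfolding admissible_def by blast
  have "\<bar>\<Phi> a A x + \<Psi> a A x\<bar> \<le> B + B'" for a A x using 1(1)[of a A x] 2(1)[of a A x] by linarith
  moreover have "(\<lambda>(a, A, x). \<Phi> a A x + \<Psi> a A x) \<in> borel_measurable borel"
    unfolding case_prod_beta by (intro borel_measurable_add admissible_measurable[OF *] admissible_measurable[OF **] borel_measurable_projs)
  moreover have "norm x \<le> max r r'" if "norm a \<le> 2" "A \<in> near_iso e" "\<Phi> a A x + \<Psi> a A x \<noteq> 0" for a A x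
    using 1(2)[of a A x] 2(2)[of a A x] that by (cases "\<Phi> a A x = 0") auto
  ultimately show ?thesis unfolding admissible_def by blast
qed

lemma admissible_sum:
  assumes "finite I" "\<And>i. i \<in> I \<Longrightarrow> admissible e (\<Phi> i)"
  shows "admissible e (\<lambda>a A x. \<Sum>i\<in>I. \<Phi> i a A x)"
  using assms
proof (induction I rule: finite_induct)
  case empty
  then show ?case by (auto simp: admissible_def case_prod_beta)
next
  case (insert i I)
  then show ?case using admissible_add[of e "\<Phi> i" "\<lambda>a A x. \<Sum>i\<in>I. \<Phi> i a A x"] by simp
qed

text \<open>A single factor with bounded support suffices; the others need only be bounded and
  measurable.\<close>

lemma admissible_mult:
  assumes *: "admissible e \<Phi>" and m: "(\<lambda>(a, A, x). \<Psi> a A x) \<in> borel_measurable borel"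
    and B': "\<And>a A x. \<bar>\<Psi> a A x\<bar> \<le> B'"
  shows "admissible e (\<lambda>a A x. \<Phi> a A x * \<Psi> a A x)"
proof -
  obtain B r where 1: "\<And>a A x. \<bar>\<Phi> a A x\<bar> \<le> B"
    "\<And>a A x. norm a \<le> 2 \<Longrightarrow> A \<in> near_iso e \<Longrightarrow> \<Phi> a A x \<noteq> 0 \<Longrightarrow> norm x \<le> r"
    using * unfolding admissible_def by blast
  have "\<bar>\<Phi> a A x * \<Psi> a A x\<bar> \<le> B * B'" for a A x
    using 1(1)[of a A x] B'[of a A x] by (simp add: abs_mult mult_mono')
  moreover have "(\<lambda>(a, A, x). \<Phi> a A x * \<Psi> a A x) \<in> borel_measurable borel"
    using m unfolding case_prod_beta by (intro borel_measurable_times admissible_measurable[OF *] borel_measurable_projs)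
  moreover have "norm x \<le> r" if "norm a \<le> 2" "A \<in> near_iso e" "\<Phi> a A x * \<Psi> a A x \<noteq> 0" for a A x
    using 1(2)[of a A x] that by auto
  ultimately show ?thesis unfolding admissible_def by blast
qed

text \<open>The integrand is bounded and vanishes outside a bounded set of triples. All later uses
  of Fubini and linearity rest on this.\<close>

lemma config_int_integrand:
  fixes \<Phi> :: "real^'n \<Rightarrow> real^'n^'n \<Rightarrow> real^'n \<Rightarrow> real"
  assumes *: "admissible e \<Phi>"
  defines "\<phi> \<equiv> \<lambda>a A x. bump a * indicator (near_iso e) A * \<Phi> a A x"
  shows "integrable lborel (\<lambda>(a, A, x). \<phi> a A x)"
    "integrable lborel (\<lambda>(A, x). \<phi> a A x)"
    "integrable lborel (\<lambda>x. \<phi> a A x)"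
    "f \<in> borel_measurable M \<Longrightarrow> g \<in> borel_measurable M \<Longrightarrow> h \<in> borel_measurable M \<Longrightarrow>
      (\<lambda>z. \<phi> (f z) (g z) (h z)) \<in> borel_measurable M"
proof -
  obtain B r where 1: "\<And>a A x. \<bar>\<Phi> a A x\<bar> \<le> B"
    "\<And>a A x. norm a \<le> 2 \<Longrightarrow> A \<in> near_iso e \<Longrightarrow> \<Phi> a A x \<noteq> 0 \<Longrightarrow> norm x \<le> r"
    using * unfolding admissible_def by blast
  have m: "(\<lambda>z. \<phi> (f z) (g z) (h z)) \<in> borel_measurable M"
    if ms [measurable]: "f \<in> borel_measurable M" "g \<in> borel_measurable M" "h \<in> borel_measurable M"
    for M :: "'z measure" and f g h
  proof -
    have [measurable]: "(\<lambda>z. \<Phi> (f z) (g z) (h z)) \<in> borel_measurable M"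
      by (rule admissible_measurable[OF * ms])
    show ?thesis unfolding \<phi>_def by measurable
  qed
  have bd: "\<bar>\<phi> a A x\<bar> \<le> B" for a A x
  proof -
    have "\<bar>\<phi> a A x\<bar> \<le> 1 * 1 * \<bar>\<Phi> a A x\<bar>"
      unfolding \<phi>_def abs_mult using bump_nonneg[of a] bump_le_1[of a]
      by (intro mult_mono) (auto simp: indicator_def)
    then show ?thesis using 1(1)[of a A x] by simp
  qed
  let ?r = "(1 + e) * real CARD('n) * real CARD('n)"
  have s: "norm a \<le> 2 \<and> norm A \<le> ?r \<and> norm x \<le> r" if "\<phi> a A x \<noteq> 0" for a A x
    using that bump_support[of a] near_iso_bounded[of A e] 1(2)[of a A x]
    by (auto simp: \<phi>_def indicator_def split: if_splits)
  have s2: "norm (A, x) \<le> ?r + r" if "\<phi> a A x \<noteq> 0" for a A x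
    using s[OF that] norm_Pair_le[of A x] by linarith
  have s3: "norm (a, A, x) \<le> 2 + (?r + r)" if "\<phi> a A x \<noteq> 0" for a A x
    using s[OF that] s2[OF that] norm_Pair_le[of a "(A, x)"] by linarith
  show "integrable lborel (\<lambda>(a, A, x). \<phi> a A x)"
    by (rule integrable_lborel_bounded_support[where B=B and r="2 + (?r + r)"])
       (use m[OF borel_measurable_projs] bd s3 in \<open>auto simp: case_prod_beta\<close>)
  show "integrable lborel (\<lambda>(A, x). \<phi> a A x)"
    by (rule integrable_lborel_bounded_support[where B=B and r="?r + r"])
       (use m[OF borel_measurable_const measurable_fst measurable_snd] bd s2 in \<open>auto simp: case_prod_beta borel_prod[symmetric]\<close>)
  show "integrable lborel (\<lambda>x. \<phi> a A x)"
    by (rule integrable_lborel_bounded_support[where B=B and r=r])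
       (use m[OF borel_measurable_const borel_measurable_const measurable_ident_sets[OF refl]] bd s in auto)
  show "f \<in> borel_measurable M \<Longrightarrow> g \<in> borel_measurable M \<Longrightarrow> h \<in> borel_measurable M \<Longrightarrow>
      (\<lambda>z. \<phi> (f z) (g z) (h z)) \<in> borel_measurable M"
    by (rule m)
qed


section \<open>Linearity, invariance and bounds for configuration integrals\<close>

lemma config_int_cmult: "config_int e (\<lambda>a A x. c * \<Phi> a A x) = c * config_int e \<Phi>"
  unfolding config_int_def integral_mult_right_zero[symmetric]
  by (intro Bochner_Integration.integral_cong) auto

lemma config_int_add:
  assumes "admissible e \<Phi>" "admissible e \<Psi>"
  shows "config_int e (\<lambda>a A x. \<Phi> a A x + \<Psi> a A x) = config_int e \<Phi> + config_int e \<Psi>"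
  unfolding config_int_def
  by (subst Bochner_Integration.integral_add[symmetric])
     (use config_int_integrand(1)[OF assms(1)] config_int_integrand(1)[OF assms(2)] in
       \<open>auto simp: case_prod_unfold algebra_simps\<close>)

lemma config_int_sum:
  assumes "finite I" "\<And>i. i \<in> I \<Longrightarrow> admissible e (\<Phi> i)"
  shows "config_int e (\<lambda>a A x. \<Sum>i\<in>I. \<Phi> i a A x) = (\<Sum>i\<in>I. config_int e (\<Phi> i))"
  using assms
proof (induction I rule: finite_induct)
  case empty
  then show ?case by (simp add: config_int_def case_prod_unfold)
next
  case (insert i I)
  then show ?case
    using config_int_add[of e "\<Phi> i" "\<lambda>a A x. \<Sum>i\<in>I. \<Phi> i a A x"] admissible_sum[of I e \<Phi>] by simp
qed

lemma config_int_mono: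
  assumes "admissible e \<Phi>" "admissible e \<Psi>"
    and "\<And>a A x. bump a \<noteq> 0 \<Longrightarrow> A \<in> near_iso e \<Longrightarrow> \<Phi> a A x \<le> \<Psi> a A x"
  shows "config_int e \<Phi> \<le> config_int e \<Psi>"
  unfolding config_int_def
proof (rule integral_mono[OF config_int_integrand(1)[OF assms(1)] config_int_integrand(1)[OF assms(2)]])
  fix z :: "(real^'a) \<times> (real^'a^'a) \<times> (real^'a)"
  obtain a A x where z: "z = (a, A, x)" by (cases z) auto
  show "(case z of (a, A, x) \<Rightarrow> bump a * indicator (near_iso e) A * \<Phi> a A x)
      \<le> (case z of (a, A, x) \<Rightarrow> bump a * indicator (near_iso e) A * \<Psi> a A x)"
    using assms(3)[of a A x] bump_nonneg[of a]
    by (cases "bump a = 0") (auto simp: z indicator_def intro: mult_left_mono)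
qed

text \<open>With \<open>A\<close> as the innermost variable, the substitution by
  \<open>A ** R a\<close> happens at fixed \<open>a\<close> and \<open>x\<close>. So
  \<open>R\<close> may depend on \<open>a\<close> in an arbitrary way: measurability is asked only
  of the two integrands.\<close>

lemma config_int_rotate:
  fixes R :: "real^'n \<Rightarrow> real^'n^'n"
  assumes R: "\<And>a. orthogonal_matrix (R a)" and 1: "admissible e \<Phi>" and 2: "admissible e \<Psi>"
    and eq: "\<And>a A x. \<Psi> a A x = \<Phi> a (A ** R a) x"
  shows "config_int e \<Psi> = config_int e \<Phi>"
proof -
  let ?w = "\<lambda>\<Phi> a A x. bump a * indicator (near_iso e) A * \<Phi> a A x :: real"
  have F: "config_int e \<Theta> = (\<integral>a. \<integral>x. \<integral>A. ?w \<Theta> a A x \<partial>lborel \<partial>lborel \<partial>lborel)" if a: "admissible e \<Theta>" for \<Theta>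
  proof -
    have "config_int e \<Theta> = (\<integral>a. \<integral>(A, x). ?w \<Theta> a A x \<partial>lborel \<partial>lborel)"
      unfolding config_int_def
      by (subst lborel_integral_fst[OF config_int_integrand(1)[OF a]]) simp
    also have "\<dots> = (\<integral>a. \<integral>x. \<integral>A. ?w \<Theta> a A x \<partial>lborel \<partial>lborel \<partial>lborel)"
      by (subst lborel_integral_snd[OF config_int_integrand(2)[OF a]]) simp
    finally show ?thesis .
  qed
  have "(\<integral>A. ?w \<Psi> a A x \<partial>lborel) = (\<integral>A. ?w \<Phi> a A x \<partial>lborel)" for a x
  proof -
    have "(\<integral>A. ?w \<Psi> a A x \<partial>lborel) = (\<integral>A. ?w \<Phi> a (A ** R a) x \<partial>lborel)"
      by (intro Bochner_Integration.integral_cong) (auto simp: eq indicator_def near_iso_mult_right[OF R])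
    also have "\<dots> = (\<integral>A. ?w \<Phi> a A x \<partial>lborel)"
      by (rule integral_lborel_matrix_mult_right[OF R, of "\<lambda>A. ?w \<Phi> a A x"])
         (rule config_int_integrand(4)[OF 1]; simp)
    finally show ?thesis .
  qed
  then show ?thesis by (simp add: F[OF 1] F[OF 2])
qed

lemma config_int_iterated:
  assumes "admissible e \<Phi>"
  shows "config_int e \<Phi> =
    (\<integral>a. \<integral>A. bump a * indicator (near_iso e) A * (\<integral>x. \<Phi> a A x \<partial>lborel) \<partial>lborel \<partial>lborel)"
proof -
  let ?w = "\<lambda>\<Phi> a A x. bump a * indicator (near_iso e) A * \<Phi> a A x :: real"
  have "config_int e \<Phi> = (\<integral>a. \<integral>(A, x). ?w \<Phi> a A x \<partial>lborel \<partial>lborel)"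
    unfolding config_int_def
    by (subst lborel_integral_fst[OF config_int_integrand(1)[OF assms]]) simp
  also have "\<dots> = (\<integral>a. \<integral>A. \<integral>x. ?w \<Phi> a A x \<partial>lborel \<partial>lborel \<partial>lborel)"
    by (subst lborel_integral_fst[OF config_int_integrand(2)[OF assms]]) simp
  finally show ?thesis by simp
qed

text \<open>Here \<open>x\<close> is innermost, so the shift may depend arbitrarily on
  \<open>a\<close> and \<open>A\<close>.\<close>

lemma config_int_translate:
  fixes s :: "real^'n \<Rightarrow> real^'n^'n \<Rightarrow> real^'n"
  assumes 1: "admissible e \<Phi>" and 2: "admissible e \<Psi>"
    and eq: "\<And>a A x. \<Psi> a A x = \<Phi> a A (x + s a A)"
  shows "config_int e \<Psi> = config_int e \<Phi>"
proof -
  have "(\<integral>x. \<Psi> a A x \<partial>lborel) = (\<integral>x. \<Phi> a A x \<partial>lborel)" for a A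
    unfolding eq
    by (rule integral_lborel_translation[of "\<Phi> a A"]) (rule admissible_measurable[OF 1]; simp)
  then show ?thesis by (simp add: config_int_iterated 1 2)
qed

text \<open>The total weight of the pairs of dilation vector and matrix, by which all estimates are
  normalised. The type argument carries the dimension.\<close>

definition config_mass :: "real \<Rightarrow> 'n::finite itself \<Rightarrow> real" where
  "config_mass e _ = (\<integral>a. bump a \<partial>(lborel :: (real^'n) measure)) * measure lborel (near_iso e :: (real^'n^'n) set)"

lemma config_mass_pos: "0 < e \<Longrightarrow> 0 < config_mass e TYPE('n::finite)"
  by (simp add: config_mass_def integral_bump_pos near_iso_measure_pos)

lemma config_int_const:
  fixes \<Phi> :: "real^'n \<Rightarrow> real^'n^'n \<Rightarrow> real^'n \<Rightarrow> real"
  assumes "admissible e \<Phi>"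
    and "\<And>a A. bump a \<noteq> 0 \<Longrightarrow> A \<in> near_iso e \<Longrightarrow> (\<integral>x. \<Phi> a A x \<partial>lborel) = c"
  shows "config_int e \<Phi> = c * config_mass e TYPE('n)"
proof -
  have "config_int e \<Phi> = (\<integral>a. \<integral>A. bump a * indicator (near_iso e) A * (\<integral>x. \<Phi> a A x \<partial>lborel) \<partial>lborel \<partial>lborel)"
    by (rule config_int_iterated[OF assms(1)])
  also have "\<dots> = (\<integral>(a::real^'n). \<integral>(A::real^'n^'n). bump a * (indicator (near_iso e) A * c) \<partial>lborel \<partial>lborel)"
  proof (intro Bochner_Integration.integral_cong refl)
    fix a A show "bump a * indicator (near_iso e) A * (\<integral>x. \<Phi> a A x \<partial>lborel) = bump a * (indicator (near_iso e) A * c)"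
      using assms(2)[of a A] by (cases "bump a = 0"; cases "A \<in> near_iso e") auto
  qed
  also have "\<dots> = c * config_mass e TYPE('n)"
    using near_iso_emeasure_finite[where 'n='n, of e] by (simp add: config_mass_def)
  finally show ?thesis .
qed

lemma config_int_le_const:
  fixes \<Phi> :: "real^'n \<Rightarrow> real^'n^'n \<Rightarrow> real^'n \<Rightarrow> real"
  assumes "admissible e \<Phi>" "admissible e \<Psi>"
    and "\<And>a A x. bump a \<noteq> 0 \<Longrightarrow> A \<in> near_iso e \<Longrightarrow> \<Phi> a A x \<le> \<Psi> a A x"
    and "\<And>a A. bump a \<noteq> 0 \<Longrightarrow> A \<in> near_iso e \<Longrightarrow> (\<integral>x. \<Psi> a A x \<partial>lborel) = c"
  shows "config_int e \<Phi> \<le> c * config_mass e TYPE('n)"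
  using config_int_mono[OF assms(1-3)] config_int_const[OF assms(2,4)] by simp

text \<open>Integrating over \<open>a\<close> before \<open>A\<close> and \<open>x\<close> lets
  cancellation in \<open>a\<close> be used. The factor in front is the measure of the
  near-isometries and not \<open>config_mass\<close>, because the bump has been absorbed into
  \<open>G\<close>.\<close>

lemma config_int_swap_bound:
  fixes \<Phi> :: "real^'n \<Rightarrow> real^'n^'n \<Rightarrow> real^'n \<Rightarrow> real"
  assumes adm: "admissible e \<Phi>"
    and G: "G \<in> borel_measurable borel" "\<And>x. \<bar>G x\<bar> \<le> B" "\<And>x. G x \<noteq> 0 \<Longrightarrow> norm x \<le> r"
    and le: "\<And>A x. A \<in> near_iso e \<Longrightarrow> \<bar>\<integral>a. bump a * \<Phi> a A x \<partial>lborel\<bar> \<le> G x"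
  shows "\<bar>config_int e \<Phi>\<bar> \<le> measure lborel (near_iso e :: (real^'n^'n) set) * (\<integral>x. G x \<partial>lborel)"
proof -
  let ?N = "near_iso e :: (real^'n^'n) set"
  let ?f = "\<lambda>(A, x). \<integral>a. bump a * indicator ?N A * \<Phi> a A x \<partial>lborel"
  have int: "integrable lborel (\<lambda>(a, A, x). bump a * indicator ?N A * \<Phi> a A x)"
    by (rule config_int_integrand(1)[OF adm])
  have eq: "config_int e \<Phi> = (\<integral>z. ?f z \<partial>lborel)"
    unfolding config_int_def by (subst lborel_integral_snd[OF int]) (simp add: case_prod_unfold)
  have intf: "integrable lborel ?f"
    using lborel_pair.integrable_snd[of "\<lambda>a z. case z of (A, x) \<Rightarrow> bump a * indicator ?N A * \<Phi> a A x"] int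
    by (simp add: lborel_prod case_prod_unfold)
  have intg: "integrable lborel (\<lambda>(A, x). indicator ?N A * G x)"
  proof (rule integrable_lborel_bounded_support[where B=B and r="(1 + e) * real CARD('n) * real CARD('n) + r"])
    have "(\<lambda>z :: (real^'n^'n) \<times> (real^'n). indicator ?N (fst z) * G (snd z)) \<in> borel_measurable (borel \<Otimes>\<^sub>M borel)"
      using G(1) by measurable
    then show "(\<lambda>(A, x). indicator ?N A * G x) \<in> borel_measurable borel"
      by (simp add: case_prod_beta borel_prod)
  next
    fix z :: "(real^'n^'n) \<times> (real^'n)"
    show "\<bar>case z of (A, x) \<Rightarrow> indicator ?N A * G x\<bar> \<le> B"
      using G(2)[of "snd z"] by (auto simp: case_prod_beta indicator_def)
    assume "(case z of (A, x) \<Rightarrow> indicator ?N A * G x) \<noteq> 0"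
    then have "fst z \<in> ?N" "G (snd z) \<noteq> 0" by (auto simp: case_prod_beta indicator_def)
    then show "norm z \<le> (1 + e) * real CARD('n) * real CARD('n) + r"
      using near_iso_bounded[of "fst z" e] G(3)[of "snd z"] norm_Pair_le[of "fst z" "snd z"] by simp
  qed
  have "\<bar>config_int e \<Phi>\<bar> \<le> (\<integral>z. \<bar>?f z\<bar> \<partial>lborel)"
    unfolding eq by (rule integral_abs_bound)
  also have "\<dots> \<le> (\<integral>(A, x). indicator ?N A * G x \<partial>lborel)"
  proof (rule integral_mono[OF integrable_abs[OF intf] intg])
    fix z :: "(real^'n^'n) \<times> (real^'n)"
    obtain A x where z: "z = (A, x)" by (cases z)
    show "\<bar>?f z\<bar> \<le> (case z of (A, x) \<Rightarrow> indicator ?N A * G x)"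
      using le[of A x] by (cases "A \<in> ?N") (auto simp: z)
  qed
  also have "\<dots> = measure lborel ?N * (\<integral>x. G x \<partial>lborel)"
    using near_iso_emeasure_finite[where 'n='n, of e] by (subst lborel_integral_fst[OF intg]) simp
  finally show ?thesis .
qed

section \<open>Averages over small cubes\<close>

text \<open>For \<open>e \<le> 1/2\<close> norms shrink at most by half, so \<open>A\<close> is
  injective, hence onto in finite dimension.\<close>

lemma near_iso_surj:
  fixes A :: "real^'n^'n"
  assumes A: "A \<in> near_iso e" and e: "e \<le> 1/2"
  obtains x where "A *v x = y" "norm x \<le> 2 * norm y"
proof -
  have h: "norm x \<le> 2 * norm (A *v x)" for x
  proof -
    have "(1/2) * norm x \<le> (1 - e) * norm x" using e by (intro mult_right_mono) auto
    then show ?thesis using norm_near_iso(2)[OF A, of x] by linarith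
  qed
  have "inj ((*v) A)"
  proof (rule injI)
    fix x z assume "A *v x = A *v z"
    then have "A *v (x - z) = 0" by (simp add: matrix_vector_mult_diff_distrib)
    then show "x = z" using h[of "x - z"] by simp
  qed
  then have "surj ((*v) A)" using linear_injective_imp_surjective by blast
  then obtain x where "A *v x = y" by (metis surjD)
  then show ?thesis using that[of x] h[of x] by simp
qed

text \<open>The point \<open>y\<close> is the lower corner of the cube, not its centre. Averaging
  therefore extends a support only downwards, by \<open>d\<close> in each coordinate.\<close>

definition cube_avg :: "real \<Rightarrow> (real^'n \<Rightarrow> real) \<Rightarrow> real^'n \<Rightarrow> real" where
  "cube_avg d f y = (\<integral>u. indicator (cbox 0 (vec d)) u * f (y + u) \<partial>lborel) / d ^ CARD('n)"

lemma measure_cube: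
  assumes "0 \<le> d"
  shows "measure lborel (cbox (0::real^'n) (vec d)) = d ^ CARD('n)"
  using assms by (subst content_cbox_cart) (auto simp: interval_eq_empty_cart)

lemma emeasure_cube_finite: "emeasure lborel (cbox a (b::'a::euclidean_space)) < \<infinity>"
  by (rule emeasure_bounded_finite) simp

lemma norm_le_cbox_cart:
  fixes u :: "real^'n"
  assumes "\<And>i. \<bar>u $ i\<bar> \<le> d"
  shows "norm u \<le> real CARD('n) * d"
  using order_trans[OF norm_le_l1_cart sum_bounded_above[of UNIV "\<lambda>i. \<bar>u $ i\<bar>" d]] assms by simp

text \<open>To be instantiated with the indicator of a compact subset of the unit cube.\<close>

locale unit_cube_function =
  fixes f :: "real^'n \<Rightarrow> real" and d :: real
  assumes f_meas [measurable]: "f \<in> borel_measurable borel"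
    and f_nonneg: "\<And>x. 0 \<le> f x" and f_le_1: "\<And>x. f x \<le> 1"
    and f_support: "\<And>x. f x \<noteq> 0 \<Longrightarrow> x \<in> cbox 0 (vec 1)"
    and d_pos: "0 < d"
begin

abbreviation "Q \<equiv> cbox 0 (vec d) :: (real^'n) set"

lemma norm_Q: "u \<in> Q \<Longrightarrow> norm u \<le> real CARD('n) * d"
  by (rule norm_le_cbox_cart) (auto simp: mem_box_cart)

lemma norm_f_support: "f x \<noteq> 0 \<Longrightarrow> norm x \<le> real CARD('n)"
  using norm_le_cbox_cart[of x 1] f_support[of x] by (auto simp: mem_box_cart)

lemma abs_f_le_1: "\<bar>f x\<bar> \<le> 1"
  using f_nonneg[of x] f_le_1[of x] by simp

lemma integrable_f: "integrable lborel f"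
  by (rule integrable_lborel_bounded_support[where B=1 and r="real CARD('n)"])
     (auto simp: abs_f_le_1 norm_f_support)

lemma integrable_Q_slice: "integrable lborel (\<lambda>u. indicator Q u * f (y + u))"
  by (rule integrable_lborel_bounded_support[where B=1 and r="real CARD('n) * d"])
     (auto simp: indicator_def abs_f_le_1 norm_Q)

lemma cube_avg_measurable [measurable]: "cube_avg d f \<in> borel_measurable borel"
proof -
  have "(\<lambda>y. \<integral>u. indicator Q u * f (y + u) \<partial>lborel) \<in> borel_measurable borel"
    by (rule lborel.borel_measurable_lebesgue_integral) measurable
  then show ?thesis unfolding cube_avg_def[abs_def] by measurable
qed

lemma cube_avg_nonneg: "0 \<le> cube_avg d f y"
  unfolding cube_avg_def using d_pos f_nonneg by (intro divide_nonneg_nonneg integral_nonneg) auto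

lemma integral_Q: "(\<integral>u. indicator Q u * c \<partial>lborel) = d ^ CARD('n) * c"
  using emeasure_cube_finite[of 0 "vec d :: real^'n"] measure_cube[of d, where 'n='n] d_pos by simp

lemma integrable_Q: "integrable lborel (\<lambda>u. indicator Q u * (c::real))"
  by (intro integrable_mult_left integrable_real_indicator emeasure_cube_finite) auto

lemma cube_avg_le_1: "cube_avg d f y \<le> 1"
proof -
  have "(\<integral>u. indicator Q u * f (y + u) \<partial>lborel) \<le> (\<integral>u. indicator Q u * 1 \<partial>lborel)"
    by (intro integral_mono[OF integrable_Q_slice integrable_Q]) (auto simp: f_le_1 indicator_def)
  also have "\<dots> = d ^ CARD('n)" using integral_Q[of 1] by simp
  finally show ?thesis unfolding cube_avg_def by (subst pos_divide_le_eq) (simp_all only: zero_less_power d_pos mult_1_left)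
qed

lemma cube_avg_support:
  assumes "cube_avg d f y \<noteq> 0"
  shows "y \<in> cbox (vec (- d)) (vec 1)"
proof -
  have "\<exists>u. indicator Q u * f (y + u) \<noteq> 0"
  proof (rule ccontr)
    assume "\<not> ?thesis"
    then have "(\<lambda>u. indicator Q u * f (y + u)) = (\<lambda>u. 0)" by blast
    then show False using assms unfolding cube_avg_def by (simp only:) simp
  qed
  then obtain u where u: "u \<in> Q" "y + u \<in> cbox 0 (vec 1)" using f_support by (auto simp: indicator_def split: if_splits)
  have "- d \<le> y $ i \<and> y $ i \<le> 1" for i
    using u(1)[unfolded mem_box_cart, rule_format, of i] u(2)[unfolded mem_box_cart, rule_format, of i] by auto
  then show ?thesis by (simp add: mem_box_cart)
qed

lemma integral_cube_avg: "(\<integral>y. cube_avg d f y \<partial>lborel) = (\<integral>y. f y \<partial>lborel)"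
proof -
  have int: "integrable lborel (\<lambda>(y, u). indicator Q u * f (y + u))"
  proof (rule integrable_lborel_bounded_support[where B=1 and r="real CARD('n) + 2 * (real CARD('n) * d)"])
    show "(\<lambda>(y, u). indicator Q u * f (y + u)) \<in> borel_measurable borel"
      unfolding borel_prod[symmetric] by measurable
  next
    fix z :: "(real^'n) \<times> (real^'n)"
    show "\<bar>case z of (y, u) \<Rightarrow> indicator Q u * f (y + u)\<bar> \<le> 1"
      using f_le_1[of "fst z + snd z"] f_nonneg[of "fst z + snd z"] by (auto simp: case_prod_unfold indicator_def)
    assume "(case z of (y, u) \<Rightarrow> indicator Q u * f (y + u)) \<noteq> 0"
    then have "snd z \<in> Q" "f (fst z + snd z) \<noteq> 0" by (auto simp: case_prod_unfold indicator_def)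
    then show "norm z \<le> real CARD('n) + 2 * (real CARD('n) * d)"
      using norm_Q[of "snd z"] norm_f_support[of "fst z + snd z"] norm_triangle_ineq4[of "fst z + snd z" "snd z"]
        norm_Pair_le[of "fst z" "snd z"] by simp
  qed
  have "(\<integral>y. cube_avg d f y \<partial>lborel) = (\<integral>y. \<integral>u. indicator Q u * f (y + u) \<partial>lborel \<partial>lborel) / d ^ CARD('n)"
    unfolding cube_avg_def by simp
  also have "(\<integral>y. \<integral>u. indicator Q u * f (y + u) \<partial>lborel \<partial>lborel) = (\<integral>u. \<integral>y. indicator Q u * f (y + u) \<partial>lborel \<partial>lborel)"
    using lborel_integral_fst[OF int] lborel_integral_snd[OF int] by simp
  also have "\<dots> = d ^ CARD('n) * (\<integral>y. f y \<partial>lborel)"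
    using d_pos by (simp add: integral_lborel_translation[OF f_meas] measure_cube)
  finally show ?thesis using d_pos by simp
qed

lemma integrable_cube_avg: "integrable lborel (cube_avg d f)"
proof (rule integrable_lborel_bounded_support[where B=1 and r="real CARD('n) * max d 1"])
  show "\<bar>cube_avg d f z\<bar> \<le> 1" for z using cube_avg_le_1[of z] cube_avg_nonneg[of z] by simp
  fix z assume "cube_avg d f z \<noteq> 0"
  then have "- d \<le> z $ i \<and> z $ i \<le> 1" for i using cube_avg_support[of z] by (simp add: mem_box_cart)
  then show "norm z \<le> real CARD('n) * max d 1"
    by (intro norm_le_cbox_cart) (smt (verit))
qed measurable

text \<open>A shift of the argument by \<open>u\<close> is a shift of \<open>a\<close> by \<open>A\<close>-preimages of \<open>u / t\<close>, so the Lipschitz weight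
  absorbs the difference between \<open>f\<close> and its cube averages.\<close>

lemma bump_osc:
  fixes A :: "real^'n^'n"
  assumes A: "A \<in> near_iso e" and e: "e \<le> 1/2" and t: "0 < t"
  shows "\<bar>\<integral>a. bump a * (f (x + t *\<^sub>R (A *v a)) - cube_avg d f (x + t *\<^sub>R (A *v a))) \<partial>lborel\<bar>
    \<le> 8 * measure lborel (cball (0::real^'n) 2) * real CARD('n) * d / t"
proof -
  let ?V = "measure lborel (cball (0::real^'n) 2)"
  \<comment> \<open>The 8 is the Lipschitz constant 2 of the bump, times the factor 2 lost in taking
    a preimage under \<open>A\<close>, times the two balls that cover the supports of the bump and
    of its translate.\<close>
  define C where "C = 8 * ?V * real CARD('n) * d / t"
  define p where "p u = (\<integral>a. bump a * f (x + t *\<^sub>R (A *v a) + u) \<partial>lborel)" for u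
  have intp: "integrable lborel (\<lambda>a. bump (a - s) * f (h a))" if [measurable]: "h \<in> borel_measurable borel" for s :: "real^'n" and h
  proof (rule integrable_lborel_bounded_support[where B=1 and r="norm s + 2"])
    fix a
    show "\<bar>bump (a - s) * f (h a)\<bar> \<le> 1"
      using bump_nonneg[of "a - s"] bump_le_1[of "a - s"] f_nonneg[of "h a"] f_le_1[of "h a"] by (simp add: mult_le_one)
    assume "bump (a - s) * f (h a) \<noteq> 0"
    then have "norm (a - s) < 2" using bump_support[of "a - s"] by auto
    then show "norm a \<le> norm s + 2" using norm_triangle_ineq[of "a - s" s] by simp
  qed measurable
  have hm: "(\<lambda>a. x + t *\<^sub>R (A *v a)) \<in> borel_measurable borel" by measurable
  have osc: "\<bar>p u - p 0\<bar> \<le> C" if u: "u \<in> Q" for u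
  proof -
    obtain s where s: "A *v s = (1 / t) *\<^sub>R u" "norm s \<le> 2 * norm ((1 / t) *\<^sub>R u)"
      using near_iso_surj[OF A e] by blast
    have sn: "norm s \<le> 2 * (real CARD('n) * d) / t"
      using s(2) norm_Q[OF u] t by (simp add: field_simps)
    have "t *\<^sub>R (A *v (a + s)) = t *\<^sub>R (A *v a) + u" for a
      using t s(1) by (simp add: matrix_vector_right_distrib scaleR_add_right)
    then have "p u = (\<integral>a. bump (a + s - s) * f (x + t *\<^sub>R (A *v (a + s))) \<partial>lborel)"
      unfolding p_def by (simp add: add.assoc)
    also have "\<dots> = (\<integral>a. bump (a - s) * f (x + t *\<^sub>R (A *v a)) \<partial>lborel)"
      by (rule integral_lborel_translation[of "\<lambda>a. bump (a - s) * f (x + t *\<^sub>R (A *v a))"]) measurable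
    finally have pu: "p u = \<dots>" .
    have p0: "p 0 = (\<integral>a. bump (a - 0) * f (x + t *\<^sub>R (A *v a)) \<partial>lborel)" by (simp add: p_def)
    have "\<bar>p u - p 0\<bar> \<le> (\<integral>a. \<bar>bump (a - s) * f (x + t *\<^sub>R (A *v a)) - bump (a - 0) * f (x + t *\<^sub>R (A *v a))\<bar> \<partial>lborel)"
      unfolding pu p0
      using integral_abs_bound[of lborel "\<lambda>a. bump (a - s) * f (x + t *\<^sub>R (A *v a)) - bump (a - 0) * f (x + t *\<^sub>R (A *v a))"]
      by (simp only: Bochner_Integration.integral_diff[OF intp[OF hm] intp[OF hm]])
    \<comment> \<open>The bump and its translate differ by at most \<open>2 * norm s\<close>, and
      only where one of them is nonzero.\<close>
    also have "\<dots> \<le> (\<integral>a. 2 * norm s * (indicator (cball 0 2) a + indicator (cball s 2) a) \<partial>lborel)"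
    proof (rule integral_mono)
      show "integrable lborel (\<lambda>a. \<bar>bump (a - s) * f (x + t *\<^sub>R (A *v a)) - bump (a - 0) * f (x + t *\<^sub>R (A *v a))\<bar>)"
        by (intro integrable_abs Bochner_Integration.integrable_diff intp) measurable
      show "integrable lborel (\<lambda>a. 2 * norm s * (indicator (cball 0 2) a + indicator (cball s 2) a :: real))"
        by (intro integrable_mult_right Bochner_Integration.integrable_add integrable_real_indicator emeasure_bounded_finite) auto
    next
      fix a
      have "\<bar>bump (a - s) - bump a\<bar> \<le> 2 * norm s * (indicator (cball 0 2) a + indicator (cball s 2) a)"
      proof (cases "bump (a - s) = 0 \<and> bump a = 0")
        case False
        then have "a \<in> cball 0 2 \<or> a \<in> cball s 2"
          using bump_support[of a] bump_support[of "a - s"] by (auto simp: dist_norm norm_minus_commute)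
        then have "1 \<le> indicator (cball 0 2) a + (indicator (cball s 2) a :: real)" by (auto simp: indicator_def)
        then have "2 * norm s * 1 \<le> 2 * norm s * (indicator (cball 0 2) a + indicator (cball s 2) a)"
          by (intro mult_left_mono) auto
        then show ?thesis using bump_lipschitz[of "a - s" a] by simp
      qed auto
      moreover have "\<bar>bump (a - s) * f (x + t *\<^sub>R (A *v a)) - bump (a - 0) * f (x + t *\<^sub>R (A *v a))\<bar>
          \<le> \<bar>bump (a - s) - bump a\<bar>"
        unfolding left_diff_distrib[symmetric] abs_mult diff_zero
        using f_nonneg f_le_1 by (intro mult_left_le) auto
      ultimately show "\<bar>bump (a - s) * f (x + t *\<^sub>R (A *v a)) - bump (a - 0) * f (x + t *\<^sub>R (A *v a))\<bar>
          \<le> 2 * norm s * (indicator (cball 0 2) a + indicator (cball s 2) a)"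
        by (rule order_trans[rotated])
    qed
    also have "\<dots> = 2 * norm s * (2 * ?V)"
    proof -
      have i: "integrable lborel (indicator (cball c 2) :: real^'n \<Rightarrow> real)" for c :: "real^'n"
        by (intro integrable_real_indicator emeasure_bounded_finite) auto
      have "measure lborel (cball s 2) = ?V"
        by (simp add: content_cball)
      then show ?thesis
        unfolding integral_mult_right_zero Bochner_Integration.integral_add[OF i i]
        by (simp only: Bochner_Integration.integral_indicator space_lborel Int_UNIV_right) simp
    qed
    also have "\<dots> \<le> 2 * (2 * (real CARD('n) * d) / t) * (2 * ?V)"
      by (rule mult_right_mono[OF mult_left_mono[OF sn]]) simp_all
    also have "\<dots> = C" by (simp add: C_def)
    finally show ?thesis .
  qed
  have int2: "integrable lborel (\<lambda>(a, u). bump a * (indicator Q u * f (x + t *\<^sub>R (A *v a) + u)))"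
  proof (rule integrable_lborel_bounded_support[where B=1 and r="2 + real CARD('n) * d"])
    show "(\<lambda>(a, u). bump a * (indicator Q u * f (x + t *\<^sub>R (A *v a) + u))) \<in> borel_measurable borel"
      unfolding borel_prod[symmetric] by measurable
  next
    fix z :: "(real^'n) \<times> (real^'n)"
    show "\<bar>case z of (a, u) \<Rightarrow> bump a * (indicator Q u * f (x + t *\<^sub>R (A *v a) + u))\<bar> \<le> 1"
      using f_le_1[of "x + t *\<^sub>R (A *v fst z) + snd z"] f_nonneg[of "x + t *\<^sub>R (A *v fst z) + snd z"]
        bump_nonneg[of "fst z"] bump_le_1[of "fst z"]
      by (auto simp: case_prod_unfold indicator_def mult_le_one)
    assume "(case z of (a, u) \<Rightarrow> bump a * (indicator Q u * f (x + t *\<^sub>R (A *v a) + u))) \<noteq> 0"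
    then have "snd z \<in> Q" "bump (fst z) \<noteq> 0" by (auto simp: case_prod_unfold indicator_def)
    then show "norm z \<le> 2 + real CARD('n) * d"
      using norm_Q[of "snd z"] bump_support[of "fst z"] norm_Pair_le[of "fst z" "snd z"] by simp
  qed
  have pull: "(\<integral>a. bump a * (indicator Q u * f (x + t *\<^sub>R (A *v a) + u)) \<partial>lborel) = indicator Q u * p u" for u
    unfolding p_def integral_mult_right_zero[symmetric]
    by (intro Bochner_Integration.integral_cong) auto
  \<comment> \<open>By Fubini the averaged term is the mean of \<open>p u\<close> over the cube, so
    the quantity to be bounded is the mean of \<open>p 0 - p u\<close>, and \<open>osc\<close>
    applies to each \<open>u\<close>.\<close>
  have "(\<integral>a. bump a * cube_avg d f (x + t *\<^sub>R (A *v a)) \<partial>lborel)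
      = (\<integral>a. \<integral>u. bump a * (indicator Q u * f (x + t *\<^sub>R (A *v a) + u)) \<partial>lborel \<partial>lborel) / d ^ CARD('n)"
    by (simp add: cube_avg_def)
  also have "(\<integral>a. \<integral>u. bump a * (indicator Q u * f (x + t *\<^sub>R (A *v a) + u)) \<partial>lborel \<partial>lborel)
      = (\<integral>u. \<integral>a. bump a * (indicator Q u * f (x + t *\<^sub>R (A *v a) + u)) \<partial>lborel \<partial>lborel)"
    using lborel_integral_fst[OF int2] lborel_integral_snd[OF int2] by simp
  also have "\<dots> = (\<integral>u. indicator Q u * p u \<partial>lborel)"
    by (simp only: pull)
  finally have avg: "(\<integral>a. bump a * cube_avg d f (x + t *\<^sub>R (A *v a)) \<partial>lborel) = (\<integral>u. indicator Q u * p u \<partial>lborel) / d ^ CARD('n)" .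
  have intQp: "integrable lborel (\<lambda>u. indicator Q u * p u)"
    using lborel_pair.integrable_snd[of "\<lambda>a u. bump a * (indicator Q u * f (x + t *\<^sub>R (A *v a) + u))"] int2
    by (simp only: lborel_prod pull)
  have intg: "integrable lborel (\<lambda>a. bump a * cube_avg d f (x + t *\<^sub>R (A *v a)))"
  proof (rule Bochner_Integration.integrable_bound[OF integrable_bump])
    show "AE a in lborel. norm (bump a * cube_avg d f (x + t *\<^sub>R (A *v a))) \<le> norm (bump a :: real)"
      using cube_avg_nonneg cube_avg_le_1 by (intro AE_I2) (auto simp: abs_mult intro!: mult_left_le)
  qed measurable
  have p0': "p 0 = (\<integral>a. bump a * f (x + t *\<^sub>R (A *v a)) \<partial>lborel)" by (simp add: p_def)
  have "(\<integral>a. bump a * (f (x + t *\<^sub>R (A *v a)) - cube_avg d f (x + t *\<^sub>R (A *v a))) \<partial>lborel)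
      = p 0 - (\<integral>u. indicator Q u * p u \<partial>lborel) / d ^ CARD('n)"
    using intp[of "\<lambda>a. x + t *\<^sub>R (A *v a)" 0] intg
    by (simp add: right_diff_distrib avg p0')
  also have "\<dots> = (\<integral>u. indicator Q u * p 0 - indicator Q u * p u \<partial>lborel) / d ^ CARD('n)"
    using d_pos by (subst Bochner_Integration.integral_diff[OF integrable_Q intQp]) (simp add: measure_cube diff_divide_distrib)
  finally have eq: "(\<integral>a. bump a * (f (x + t *\<^sub>R (A *v a)) - cube_avg d f (x + t *\<^sub>R (A *v a))) \<partial>lborel) = \<dots>" .
  have "\<bar>\<integral>u. indicator Q u * p 0 - indicator Q u * p u \<partial>lborel\<bar> \<le> (\<integral>u. \<bar>indicator Q u * p 0 - indicator Q u * p u\<bar> \<partial>lborel)"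
    by (rule integral_abs_bound)
  also have "\<dots> \<le> (\<integral>u. indicator Q u * C \<partial>lborel)"
  proof (intro integral_mono integrable_abs Bochner_Integration.integrable_diff integrable_Q intQp)
    fix u show "\<bar>indicator Q u * p 0 - indicator Q u * p u\<bar> \<le> indicator Q u * C"
      using osc[of u] by (cases "u \<in> Q") (simp_all add: abs_minus_commute)
  qed
  also have "\<dots> = d ^ CARD('n) * C" by (rule integral_Q)
  finally have "\<bar>\<integral>u. indicator Q u * p 0 - indicator Q u * p u \<partial>lborel\<bar> / d ^ CARD('n) \<le> C"
    using d_pos by (simp add: pos_divide_le_eq mult.commute)
  then show ?thesis
    using d_pos unfolding eq C_def[symmetric] by simp
qed

end

section \<open>Replacing one factor by its average\<close>

lemma admissible_base:
  fixes k :: "real^'n \<Rightarrow> real"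
  assumes k: "k \<in> borel_measurable borel" "\<And>x. \<bar>k x\<bar> \<le> B" "\<And>x. k x \<noteq> 0 \<Longrightarrow> norm x \<le> r"
  shows "admissible e (\<lambda>a A x. k (x + (c * norm a) *\<^sub>R (A *v w)))"
    and "(\<lambda>(a :: real^'n, A :: real^'n^'n, x). k (x + (c * norm a) *\<^sub>R (A *v w))) \<in> borel_measurable borel"
proof -
  have "(\<lambda>z :: (real^'n) \<times> (real^'n^'n) \<times> (real^'n). snd (snd z) + (c * norm (fst z)) *\<^sub>R (fst (snd z) *v w)) \<in> borel_measurable borel"
    by (intro borel_measurable_continuous_onI continuous_intros)
  from measurable_compose[OF this k(1)]
  show m: "(\<lambda>(a :: real^'n, A :: real^'n^'n, x). k (x + (c * norm a) *\<^sub>R (A *v w))) \<in> borel_measurable borel"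
    by (simp add: case_prod_unfold)
  have "norm x \<le> r + \<bar>c\<bar> * 2 * ((1 + e) * norm w)"
    if a: "norm a \<le> 2" and A: "A \<in> near_iso e" and nz: "k (x + (c * norm a) *\<^sub>R (A *v w)) \<noteq> 0"
    for a :: "real^'n" and A :: "real^'n^'n" and x
  proof -
    let ?y = "(c * norm a) *\<^sub>R (A *v w)"
    have "norm ?y = (\<bar>c\<bar> * norm a) * norm (A *v w)" by (simp add: abs_mult)
    also have "\<dots> \<le> (\<bar>c\<bar> * 2) * ((1 + e) * norm w)"
      using a norm_near_iso(1)[OF A, of w] by (intro mult_mono mult_left_mono) auto
    finally have "norm ?y \<le> (\<bar>c\<bar> * 2) * ((1 + e) * norm w)" .
    moreover have "norm (x + ?y) \<le> r" by (rule k(3)[OF nz])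
    moreover have "norm x \<le> norm (x + ?y) + norm ?y"
      using norm_triangle_ineq4[of "x + ?y" ?y] by simp
    ultimately show ?thesis by linarith
  qed
  then show "admissible e (\<lambda>a A x. k (x + (c * norm a) *\<^sub>R (A *v w)))"
    unfolding admissible_def using m k(2) by blast
qed

lemma config_prod_measurable:
  fixes k :: "'i \<Rightarrow> real^'n \<Rightarrow> real" and w :: "'i \<Rightarrow> real^'n"
  assumes "\<And>i. i \<in> I \<Longrightarrow> k i \<in> borel_measurable borel"
  shows "(\<lambda>(a :: real^'n, A :: real^'n^'n, x). \<Prod>i\<in>I. k i (x + (c * norm a) *\<^sub>R (A *v w i))) \<in> borel_measurable borel"
proof -
  have "(\<lambda>z :: (real^'n) \<times> (real^'n^'n) \<times> (real^'n). snd (snd z) + (c * norm (fst z)) *\<^sub>R (fst (snd z) *v w i)) \<in> borel_measurable borel" for i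
    by (intro borel_measurable_continuous_onI continuous_intros)
  from measurable_compose[OF this assms] show ?thesis
    unfolding case_prod_unfold by (intro borel_measurable_prod) auto
qed

text \<open>A pointwise replacement for Cauchy-Schwarz. Since \<open>p\<close> takes values in
  [0,1], its square is bounded by \<open>p\<close> itself, so only the integral of \<open>p\<close>
  is needed afterwards.\<close>

lemma young_product:
  fixes p q t :: real
  assumes "0 \<le> p" "p \<le> 1" "0 < t"
  shows "p * q \<le> t / 2 * p + 1 / (2 * t) * q\<^sup>2"
proof -
  have "0 \<le> (t * p - q)\<^sup>2 / (2 * t)" using assms by simp
  also have "\<dots> = t / 2 * p\<^sup>2 + 1 / (2 * t) * q\<^sup>2 - p * q"
    using assms by (simp add: power2_eq_square field_simps)
  finally have "p * q \<le> t / 2 * p\<^sup>2 + 1 / (2 * t) * q\<^sup>2" by simp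
  also have "t / 2 * p\<^sup>2 \<le> t / 2 * p"
    using assms by (intro mult_left_mono) (auto simp: power2_eq_square mult_left_le)
  finally show ?thesis by simp
qed

lemma orthogonal_matrix_exists_map:
  fixes x y :: "real^'n"
  assumes "norm x = norm y"
  shows "\<exists>R. orthogonal_matrix R \<and> R *v x = y"
proof -
  obtain f where f: "orthogonal_transformation f" "f x = y"
    using orthogonal_transformation_exists[OF assms] by blast
  then have "orthogonal_matrix (matrix f)" "matrix f *v x = y"
    using orthogonal_transformation_matrix[of f] by (auto simp: matrix_works orthogonal_transformation_linear)
  then show ?thesis by blast
qed

text \<open>The factor in \<open>bump_osc\<close> that depends on the dimension alone.\<close>

definition osc_const :: "'n::finite itself \<Rightarrow> real" where
  "osc_const _ = 8 * measure lborel (cball (0::real^'n) 2) * real CARD('n)"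

lemma osc_const_nonneg: "0 \<le> osc_const TYPE('n::finite)"
  by (simp add: osc_const_def)

section \<open>Deviation from the cube average and its correlations\<close>

context unit_cube_function
begin

definition "dev x = f x - cube_avg d f x"

lemma dev_measurable [measurable]: "dev \<in> borel_measurable borel"
  unfolding dev_def[abs_def] by measurable

lemma abs_dev_le_1: "\<bar>dev x\<bar> \<le> 1"
  using f_nonneg[of x] f_le_1[of x] cube_avg_nonneg[of x] cube_avg_le_1[of x] by (simp add: dev_def)

definition "supp_radius = real CARD('n) * max d 1"

lemma norm_f_support': "f x \<noteq> 0 \<Longrightarrow> norm x \<le> supp_radius"
  using norm_f_support[of x] unfolding supp_radius_def
  by (rule order_trans) (simp_all add: mult_le_cancel_left1)

lemma norm_cube_avg_support:
  assumes "cube_avg d f x \<noteq> 0" shows "norm x \<le> supp_radius"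
proof -
  have "- d \<le> x $ i \<and> x $ i \<le> 1" for i using cube_avg_support[OF assms] by (simp add: mem_box_cart)
  then show ?thesis unfolding supp_radius_def by (intro norm_le_cbox_cart) (smt (verit))
qed

lemma norm_dev_support: "dev x \<noteq> 0 \<Longrightarrow> norm x \<le> supp_radius"
  using norm_f_support'[of x] norm_cube_avg_support[of x] by (cases "f x = 0") (auto simp: dev_def)

lemma integral_f_le_1: "(\<integral>x. f x \<partial>lborel) \<le> 1"
proof -
  have i: "integrable lborel (indicator (cbox 0 (vec 1)) :: real^'n \<Rightarrow> real)"
    by (intro integrable_real_indicator emeasure_cube_finite) simp
  have "(\<integral>x. f x \<partial>lborel) \<le> (\<integral>x. indicator (cbox 0 (vec 1 :: real^'n)) x \<partial>lborel)"
  proof (rule integral_mono[OF integrable_f i])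
    fix x show "f x \<le> indicator (cbox 0 (vec 1)) x"
      using f_support[of x] f_le_1[of x] by (cases "f x = 0") auto
  qed
  also have "\<dots> = 1" using measure_cube[of 1, where 'n='n] by simp
  finally show ?thesis .
qed

lemma integrable_dev: "integrable lborel dev"
  unfolding dev_def[abs_def] by (intro Bochner_Integration.integrable_diff integrable_f integrable_cube_avg)

text \<open>\<open>dev\<close> is a difference of two nonnegative functions with the same integral,
  which is at most 1.\<close>

lemma integral_abs_dev: "(\<integral>x. \<bar>dev x\<bar> \<partial>lborel) \<le> 2"
proof -
  have "(\<integral>x. \<bar>dev x\<bar> \<partial>lborel) \<le> (\<integral>x. f x + cube_avg d f x \<partial>lborel)"
  proof (rule integral_mono)
    show "\<bar>dev x\<bar> \<le> f x + cube_avg d f x" for x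
      using f_nonneg[of x] cube_avg_nonneg[of x] by (simp add: dev_def)
  qed (intro integrable_abs integrable_dev Bochner_Integration.integrable_add integrable_f integrable_cube_avg)+
  also have "\<dots> = 2 * (\<integral>x. f x \<partial>lborel)"
    by (simp add: Bochner_Integration.integral_add integrable_f integrable_cube_avg integral_cube_avg)
  finally show ?thesis using integral_f_le_1 by simp
qed

text \<open>Translating \<open>x\<close> reduces to displacements 0 and \<open>q' - q\<close>. A
  rotation depending on \<open>a\<close> then turns \<open>norm a\<close> times the displacement
  into \<open>norm (q' - q)\<close> times \<open>a\<close>. The second factor becomes
  \<open>dev\<close> averaged over a solid shell, which \<open>bump_osc\<close> controls at scale
  \<open>c * norm (q' - q)\<close>.\<close>

lemma dev_correlation:
  fixes q q' :: "real^'n"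
  assumes e: "0 < e" "e \<le> 1/2" and c: "0 < c" and s0: "0 < s0" "s0 \<le> norm (q' - q)"
  shows "\<bar>config_int e (\<lambda>a A x. dev (x + (c * norm a) *\<^sub>R (A *v q)) * dev (x + (c * norm a) *\<^sub>R (A *v q')))\<bar>
    \<le> 2 * measure lborel (near_iso e :: (real^'n^'n) set) * (osc_const TYPE('n) * d / (c * s0))"
proof -
  let ?D = "q' - q" and ?s = "norm (q' - q)"
  \<comment> \<open>Both vectors have norm \<open>norm a * norm (q' - q)\<close>. No regularity of
    the choice of \<open>R\<close> in \<open>a\<close> is required.\<close>
  have "\<exists>R. orthogonal_matrix R \<and> R *v (norm a *\<^sub>R ?D) = ?s *\<^sub>R a" for a :: "real^'n"
    by (rule orthogonal_matrix_exists_map) simp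
  then obtain R :: "real^'n \<Rightarrow> real^'n^'n" where R: "\<And>a. orthogonal_matrix (R a)" "\<And>a. R a *v (norm a *\<^sub>R ?D) = ?s *\<^sub>R a"
    by metis
  let ?\<Psi>0 = "\<lambda>a A x. dev (x + (c * norm a) *\<^sub>R (A *v q)) * dev (x + (c * norm a) *\<^sub>R (A *v q'))"
  let ?\<Phi>1 = "\<lambda>a A x. dev x * dev (x + (c * norm a) *\<^sub>R (A *v ?D))"
  let ?\<Psi>2 = "\<lambda>a A x. dev x * dev (x + (c * ?s) *\<^sub>R (A *v a))"
  note base = admissible_base[OF dev_measurable abs_dev_le_1 norm_dev_support]
  have adm0: "admissible e ?\<Psi>0"
    by (rule admissible_mult[OF base(1) base(2) abs_dev_le_1])
  have base0: "admissible e (\<lambda>a A x. dev x)"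
    using base(1)[of e 0 0] by simp
  have adm1: "admissible e ?\<Phi>1"
    by (rule admissible_mult[OF base0 base(2) abs_dev_le_1])
  have "(\<lambda>z :: (real^'n) \<times> (real^'n^'n) \<times> (real^'n). snd (snd z) + (c * ?s) *\<^sub>R (fst (snd z) *v fst z)) \<in> borel_measurable borel"
    by (intro borel_measurable_continuous_onI continuous_intros)
  from measurable_compose[OF this dev_measurable]
  have adm2: "admissible e ?\<Psi>2"
    by (intro admissible_mult[OF base0 _ abs_dev_le_1]) (simp add: case_prod_unfold)
  have "config_int e ?\<Psi>0 = config_int e ?\<Phi>1"
    by (rule config_int_translate[OF adm1 adm0, of "\<lambda>a A. (c * norm a) *\<^sub>R (A *v q)"])
       (simp add: matrix_vector_mult_diff_distrib scaleR_diff_right)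
  also have "config_int e ?\<Phi>1 = config_int e ?\<Psi>2"
  proof (rule config_int_rotate[OF R(1) adm1 adm2, symmetric])
    fix a :: "real^'n" and A :: "real^'n^'n" and x
    have "(c * norm a) *\<^sub>R ((A ** R a) *v ?D) = c *\<^sub>R (A *v (R a *v (norm a *\<^sub>R ?D)))"
      by (simp add: matrix_vector_mul_assoc[symmetric] matrix_vector_mult_scaleR)
    also have "\<dots> = (c * ?s) *\<^sub>R (A *v a)" unfolding R(2) by (simp add: matrix_vector_mult_scaleR)
    finally show "?\<Psi>2 a A x = dev x * dev (x + (c * norm a) *\<^sub>R ((A ** R a) *v ?D))" by simp
  qed
  finally have eq: "config_int e ?\<Psi>0 = config_int e ?\<Psi>2" .
  let ?K = "osc_const TYPE('n) * d / (c * s0)"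
  have K: "0 \<le> ?K" using osc_const_nonneg[where 'n='n] c s0 d_pos by simp
  \<comment> \<open>The factor \<open>dev x\<close> does not involve \<open>a\<close>, so it leaves
    the inner integral and contributes its L^1 norm, at most 2.\<close>
  have "\<bar>config_int e ?\<Psi>2\<bar> \<le> measure lborel (near_iso e :: (real^'n^'n) set) * (\<integral>x. \<bar>dev x\<bar> * ?K \<partial>lborel)"
  proof (rule config_int_swap_bound[OF adm2])
    show "(\<lambda>x. \<bar>dev x\<bar> * ?K) \<in> borel_measurable borel" by measurable
    show "\<bar>\<bar>dev x\<bar> * ?K\<bar> \<le> 1 * ?K" for x
      using abs_dev_le_1[of x] K unfolding abs_mult abs_abs by (intro mult_mono) auto
    show "\<bar>dev x\<bar> * ?K \<noteq> 0 \<Longrightarrow> norm x \<le> supp_radius" for x using norm_dev_support[of x] by auto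
    fix A :: "real^'n^'n" and x assume A: "A \<in> near_iso e"
    have "(\<integral>a. bump a * (dev x * dev (x + (c * ?s) *\<^sub>R (A *v a))) \<partial>lborel)
        = dev x * (\<integral>a. bump a * dev (x + (c * ?s) *\<^sub>R (A *v a)) \<partial>lborel)"
      unfolding integral_mult_right_zero[symmetric]
      by (intro Bochner_Integration.integral_cong) auto
    moreover have "\<bar>\<integral>a. bump a * dev (x + (c * ?s) *\<^sub>R (A *v a)) \<partial>lborel\<bar> \<le> osc_const TYPE('n) * d / (c * ?s)"
      unfolding dev_def osc_const_def by (intro bump_osc[OF A e(2)] mult_pos_pos c less_le_trans[OF s0])
    moreover have "osc_const TYPE('n) * d / (c * ?s) \<le> ?K"
      using osc_const_nonneg[where 'n='n] c s0 d_pos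
      by (intro divide_left_mono mult_left_mono mult_pos_pos less_le_trans[OF s0]) auto
    ultimately show "\<bar>\<integral>a. bump a * (dev x * dev (x + (c * ?s) *\<^sub>R (A *v a))) \<partial>lborel\<bar> \<le> \<bar>dev x\<bar> * ?K"
      by (simp only: abs_mult) (intro mult_left_mono, auto)
  qed
  also have "\<dots> = measure lborel (near_iso e :: (real^'n^'n) set) * ((\<integral>x. \<bar>dev x\<bar> \<partial>lborel) * ?K)" by simp
  also have "\<dots> \<le> measure lborel (near_iso e :: (real^'n^'n) set) * (2 * ?K)"
    by (rule mult_left_mono[OF mult_right_mono[OF integral_abs_dev K]]) simp
  finally show ?thesis unfolding eq by (simp only: mult_ac)
qed

text \<open>The diagonal case, where no cancellation is available: \<open>dev\<close> is bounded by
  1, so its square is at most its absolute value.\<close>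

lemma dev_square:
  fixes q :: "real^'n"
  assumes e: "0 < e"
  shows "\<bar>config_int e (\<lambda>a A x. dev (x + (c * norm a) *\<^sub>R (A *v q)) * dev (x + (c * norm a) *\<^sub>R (A *v q)))\<bar>
    \<le> 2 * config_mass e TYPE('n)"
proof -
  let ?\<Phi> = "\<lambda>a A x. dev (x + (c * norm a) *\<^sub>R (A *v q)) * dev (x + (c * norm a) *\<^sub>R (A *v q))"
  let ?\<Psi> = "\<lambda>a A x. \<bar>dev (x + (c * norm a) *\<^sub>R (A *v q))\<bar>"
  note base = admissible_base[OF dev_measurable abs_dev_le_1 norm_dev_support]
  have adm: "admissible e ?\<Phi>"
    by (rule admissible_mult[OF base(1) base(2) abs_dev_le_1])
  have adm': "admissible e ?\<Psi>"
    by (rule admissible_base(1)[of "\<lambda>x. \<bar>dev x\<bar>" 1 supp_radius]) (use abs_dev_le_1 norm_dev_support in \<open>auto\<close>)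
  have "config_int e ?\<Phi> \<le> (\<integral>x. \<bar>dev x\<bar> \<partial>lborel) * config_mass e TYPE('n)"
  proof (rule config_int_le_const[OF adm adm'])
    fix a A x
    have "dev y * dev y \<le> \<bar>dev y\<bar>" for y
      using abs_dev_le_1[of y] mult_left_le[of "\<bar>dev y\<bar>" "\<bar>dev y\<bar>"] by (simp add: abs_mult_self_eq)
    then show "?\<Phi> a A x \<le> ?\<Psi> a A x" .
  next
    fix a A
    show "(\<integral>x. ?\<Psi> a A x \<partial>lborel) = (\<integral>x. \<bar>dev x\<bar> \<partial>lborel)"
      by (rule integral_lborel_translation[of "\<lambda>x. \<bar>dev x\<bar>"]) measurable
  qed
  also have "\<dots> \<le> 2 * config_mass e TYPE('n)"
    using config_mass_pos[OF e, where 'n='n] integral_abs_dev by (intro mult_right_mono) auto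
  finally have "config_int e ?\<Phi> \<le> 2 * config_mass e TYPE('n)" .
  moreover have "0 \<le> config_int e ?\<Phi>"
    unfolding config_int_def
    by (rule Bochner_Integration.integral_nonneg) (auto simp: case_prod_unfold bump_nonneg)
  ultimately show ?thesis by simp
qed

text \<open>The rotations fix every \<open>u i\<close>, so replacing \<open>q\<close> by
  \<open>R m *v q\<close> leaves the integral unchanged and \<open>dev\<close> may be averaged over
  all \<open>m\<close>. The inequality of \<open>young_product\<close> separates that average from
  the product; expanding its square gives M diagonal terms and at most M^2 correlations between
  separated points.\<close>

lemma config_term_bound:
  fixes F :: "'i \<Rightarrow> real^'n \<Rightarrow> real" and u :: "'i \<Rightarrow> real^'n" and q :: "real^'n" and R :: "nat \<Rightarrow> real^'n^'n"
  assumes e: "0 < e" "e \<le> 1/2" and c: "0 < c" and th: "0 < \<theta>" and s0: "0 < s0" and M: "0 < M"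
    and I: "finite I" "i0 \<in> I" "u i0 = 0"
    and F: "\<And>i. i \<in> I \<Longrightarrow> F i \<in> borel_measurable borel" "\<And>i x. 0 \<le> F i x" "\<And>i x. F i x \<le> 1"
    and F0: "\<And>x. F i0 x \<noteq> 0 \<Longrightarrow> norm x \<le> r" "(\<integral>x. F i0 x \<partial>lborel) \<le> 1"
    and R: "\<And>m. m < M \<Longrightarrow> orthogonal_matrix (R m)"
    and Ru: "\<And>m i. m < M \<Longrightarrow> i \<in> I \<Longrightarrow> R m *v u i = u i"
    and sep: "\<And>m m'. m < M \<Longrightarrow> m' < M \<Longrightarrow> m \<noteq> m' \<Longrightarrow> s0 \<le> norm (R m' *v q - R m *v q)"
  defines "Z \<equiv> config_mass e TYPE('n)" and "G \<equiv> measure lborel (near_iso e :: (real^'n^'n) set)"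
  shows "\<bar>config_int e (\<lambda>a A x. (\<Prod>i\<in>I. F i (x + (c * norm a) *\<^sub>R (A *v u i))) * dev (x + (c * norm a) *\<^sub>R (A *v q)))\<bar>
    \<le> \<theta> / 2 * Z + 1 / (2 * \<theta>) * (2 * Z / real M + 2 * G * (osc_const TYPE('n) * d / (c * s0)))"
proof -
  define P where "P a A x = (\<Prod>i\<in>I. F i (x + (c * norm a) *\<^sub>R (A *v u i)))" for a :: "real^'n" and A :: "real^'n^'n" and x
  define H where "H m a A x = dev (x + (c * norm a) *\<^sub>R (A *v (R m *v q)))" for m and a :: "real^'n" and A :: "real^'n^'n" and x
  note base = admissible_base[OF dev_measurable abs_dev_le_1 norm_dev_support]
  have P01: "0 \<le> P a A x" "P a A x \<le> 1" for a A x
    unfolding P_def using F by (auto intro: prod_nonneg prod_le_1)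
  \<comment> \<open>The vertex \<open>i0\<close> is at the origin, so its factor involves neither
    \<open>a\<close> nor \<open>A\<close>. It serves as an integrable majorant of the whole
    product.\<close>
  have PF: "P a A x \<le> F i0 x" for a A x
  proof -
    have "P a A x = F i0 x * (\<Prod>i\<in>I - {i0}. F i (x + (c * norm a) *\<^sub>R (A *v u i)))"
      unfolding P_def using I by (subst prod.remove[OF I(1,2)]) simp
    also have "\<dots> \<le> F i0 x"
      using F by (intro mult_left_le prod_le_1) auto
    finally show ?thesis .
  qed
  have Pm: "(\<lambda>(a, A, x). P a A x) \<in> borel_measurable borel"
    unfolding P_def by (rule config_prod_measurable[OF F(1)])
  have P1: "\<bar>P a A x\<bar> \<le> 1" for a A x using P01[of a A x] by simp
  have admH: "admissible e (H m)" for m unfolding H_def by (rule base(1))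
  have Hm: "(\<lambda>(a, A, x). H m a A x) \<in> borel_measurable borel" for m unfolding H_def by (rule base(2))
  have H1: "\<bar>H m a A x\<bar> \<le> 1" for m a A x unfolding H_def by (rule abs_dev_le_1)
  have admF: "admissible e (\<lambda>a A x. F i0 x)"
    using admissible_base(1)[of "F i0" 1 r e 0 0] F F0 I by simp
  let ?\<Phi> = "\<lambda>a A x. P a A x * dev (x + (c * norm a) *\<^sub>R (A *v q))"
  have adm\<Phi>: "admissible e ?\<Phi>"
    using admissible_mult[OF base(1) Pm P1, of e c q] by (simp add: mult.commute)
  have admPH: "admissible e (\<lambda>a A x. P a A x * H m a A x)" for m
    using admissible_mult[OF admH Pm P1, of m] by (simp add: mult.commute)
  have rot: "config_int e (\<lambda>a A x. P a A x * H m a A x) = config_int e ?\<Phi>" if m: "m < M" for m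
  proof (rule config_int_rotate[OF R[OF m] adm\<Phi> admPH])
    fix a A x
    show "P a A x * H m a A x = P a (A ** R m) x * dev (x + (c * norm a) *\<^sub>R (A ** R m *v q))"
      unfolding P_def H_def matrix_vector_mul_assoc[symmetric] using Ru[OF m] by (simp cong: prod.cong)
  qed
  let ?S = "\<lambda>a A x. (\<Sum>m<M. H m a A x)"
  have admS: "admissible e ?S" by (intro admissible_sum admH) simp
  have S1: "\<bar>?S a A x\<bar> \<le> real M" for a A x
    using order_trans[OF sum_abs sum_bounded_above[of "{..<M}" "\<lambda>m. \<bar>H m a A x\<bar>" 1]] H1 by simp
  have Sm: "(\<lambda>(a, A, x). ?S a A x) \<in> borel_measurable borel"
    using Hm unfolding case_prod_unfold by (intro borel_measurable_sum) auto
  have avg: "real M * config_int e ?\<Phi> = config_int e (\<lambda>a A x. P a A x * ?S a A x)"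
    unfolding sum_distrib_left by (subst config_int_sum) (auto simp: rot admPH)
  have admSS: "admissible e (\<lambda>a A x. ?S a A x * ?S a A x)"
    by (rule admissible_mult[OF admS Sm S1])
  have admPS: "admissible e (\<lambda>a A x. P a A x * ?S a A x)"
    using admissible_mult[OF admS Pm P1] by (simp add: mult.commute)
  have admHH: "admissible e (\<lambda>a A x. H m a A x * H m' a A x)" for m m'
    by (rule admissible_mult[OF admH Hm H1])
  define K where "K = 2 * G * (osc_const TYPE('n) * d / (c * s0))"
  have K: "0 \<le> K" unfolding K_def G_def using osc_const_nonneg[where 'n='n] c s0 d_pos by simp
  have Z: "0 < Z" unfolding Z_def by (rule config_mass_pos[OF e(1)])
  \<comment> \<open>The nonnegative \<open>K\<close> is granted to the diagonal terms as well, so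
    that the double sum splits evenly.\<close>
  have pair: "config_int e (\<lambda>a A x. H m a A x * H m' a A x) \<le> (if m = m' then 2 * Z else 0) + K"
    if "m < M" "m' < M" for m m'
  proof (cases "m = m'")
    case True
    then show ?thesis using dev_square[OF e(1), of c "R m *v q"] K unfolding H_def Z_def by simp
  next
    case False
    then show ?thesis
      using dev_correlation[OF e c s0 sep[OF that False]] unfolding H_def K_def G_def by simp
  qed
  have "config_int e (\<lambda>a A x. ?S a A x * ?S a A x) = (\<Sum>m<M. \<Sum>m'<M. config_int e (\<lambda>a A x. H m a A x * H m' a A x))"
    unfolding sum_product
    by (subst config_int_sum; (intro admissible_sum admHH)?; simp?) (subst config_int_sum; (intro admHH)?; simp)
  also have "\<dots> \<le> (\<Sum>m<M. \<Sum>m'<M. (if m = m' then 2 * Z else 0) + K)"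
    by (intro sum_mono pair) auto
  also have "\<dots> = real M * (2 * Z) + real M * real M * K"
    by (simp add: sum.distrib distrib_left)
  finally have SS: "config_int e (\<lambda>a A x. ?S a A x * ?S a A x) \<le> real M * (2 * Z) + real M * real M * K" .
  have TF: "config_int e (\<lambda>a A x. F i0 x) \<le> Z"
  proof -
    have "config_int e (\<lambda>a A x. F i0 x) = (\<integral>x. F i0 x \<partial>lborel) * Z"
      unfolding Z_def by (rule config_int_const[OF admF]) simp
    also have "\<dots> \<le> 1 * Z" using F0(2) Z by (intro mult_right_mono) auto
    finally show ?thesis by simp
  qed
  \<comment> \<open>This is \<open>young_product\<close> with \<open>q\<close> the mean
    \<open>?S / M\<close>, multiplied through by M.\<close>
  let ?B = "\<lambda>a A x. (\<theta> / 2 * real M) * F i0 x + (1 / (2 * \<theta> * real M)) * (?S a A x * ?S a A x)"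
  have admB: "admissible e ?B"
    by (intro admissible_add admissible_cmult admF admSS)
  have TB: "config_int e ?B \<le> real M * (\<theta> / 2 * Z + 1 / (2 * \<theta>) * (2 * Z / real M + K))"
  proof -
    have "config_int e ?B = (\<theta> / 2 * real M) * config_int e (\<lambda>a A x. F i0 x)
        + (1 / (2 * \<theta> * real M)) * config_int e (\<lambda>a A x. ?S a A x * ?S a A x)"
      by (simp only: config_int_add[OF admissible_cmult[OF admF] admissible_cmult[OF admSS]] config_int_cmult)
    also have "\<dots> \<le> (\<theta> / 2 * real M) * Z + (1 / (2 * \<theta> * real M)) * (real M * (2 * Z) + real M * real M * K)"
      using TF SS th by (intro add_mono mult_left_mono) auto
    also have "\<dots> = real M * (\<theta> / 2 * Z + 1 / (2 * \<theta>) * (2 * Z / real M + K))"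
      using M th by (simp add: field_simps)
    finally show ?thesis .
  qed
  \<comment> \<open>The sign \<open>w\<close> takes care of the absolute value: the bound is applied
    to the integral and to its negative.\<close>
  have le: "w * (P a A x * ?S a A x) \<le> ?B a A x" if w: "w = 1 \<or> w = -1" for w a A x
  proof -
    have "w * (P a A x * ?S a A x) = real M * (P a A x * (w * ?S a A x / real M))" using M by simp
    also have "\<dots> \<le> real M * (\<theta> / 2 * P a A x + 1 / (2 * \<theta>) * (w * ?S a A x / real M)\<^sup>2)"
      by (intro mult_left_mono young_product P01 th) simp
    also have "\<dots> \<le> real M * (\<theta> / 2 * F i0 x + 1 / (2 * \<theta>) * (w * ?S a A x / real M)\<^sup>2)"
      using th PF by (intro mult_left_mono add_right_mono) auto
    also have "\<dots> = ?B a A x"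
      using w M by (auto simp: power2_eq_square field_simps)
    finally show ?thesis .
  qed
  have "w * (real M * config_int e ?\<Phi>) \<le> config_int e ?B" if w: "w = 1 \<or> w = -1" for w
    using config_int_mono[OF admissible_cmult[OF admPS, of w] admB le[OF w]] unfolding avg config_int_cmult .
  from this[of 1] this[of "-1"] have "real M * \<bar>config_int e ?\<Phi>\<bar> \<le> config_int e ?B"
    using M by (simp add: abs_if)
  also note TB
  finally have "\<bar>config_int e ?\<Phi>\<bar> \<le> \<theta> / 2 * Z + 1 / (2 * \<theta>) * (2 * Z / real M + K)"
    using M by simp
  then show ?thesis unfolding P_def K_def .
qed

end

section \<open>Rotations moving a single vertex\<close>

text \<open>The Householder reflection in the hyperplane orthogonal to \<open>z - z'\<close>
  exchanges vectors of equal norm and fixes everything orthogonal to both.\<close>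

lemma reflection_exists:
  fixes z z' :: "real^'n"
  assumes "norm z = norm z'"
  shows "\<exists>R. orthogonal_matrix R \<and> R *v z = z' \<and> (\<forall>u. u \<bullet> z = 0 \<longrightarrow> u \<bullet> z' = 0 \<longrightarrow> R *v u = u)"
proof -
  define b where "b = z - z'"
  \<comment> \<open>If \<open>z = z'\<close>, division by zero gives 0 and \<rho> is the identity,
    as it should be.\<close>
  define k where "k x = 2 * (x \<bullet> b) / (b \<bullet> b)" for x
  define \<rho> where "\<rho> x = x - k x *\<^sub>R b" for x
  have lin: "linear \<rho>"
    unfolding \<rho>_def k_def by (intro linearI) (simp_all add: inner_add_left algebra_simps add_divide_distrib)
  have "\<rho> x \<bullet> \<rho> y = x \<bullet> y" for x y
  proof -
    have k: "k x * (b \<bullet> b) = 2 * (x \<bullet> b)" for x by (cases "b = 0") (simp_all add: k_def)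
    have "\<rho> x \<bullet> \<rho> y = x \<bullet> y - k y * (x \<bullet> b) - k x * (y \<bullet> b) + k x * (k y * (b \<bullet> b))"
      by (simp add: \<rho>_def inner_diff_left inner_diff_right inner_commute algebra_simps)
    also have "\<dots> = x \<bullet> y - k y * (x \<bullet> b) + k x * (y \<bullet> b)" by (simp add: k)
    also have "k x * (y \<bullet> b) = k y * (x \<bullet> b)" by (simp add: k_def)
    finally show ?thesis by simp
  qed
  then have "orthogonal_transformation \<rho>" using lin by (simp add: orthogonal_transformation_def)
  then have R: "orthogonal_matrix (matrix \<rho>)" "matrix \<rho> *v x = \<rho> x" for x
    using orthogonal_transformation_matrix[of \<rho>] by (auto simp: matrix_works)
  have "\<rho> z = z'"
  proof (cases "b = 0")
    case False
    have "z \<bullet> z = z' \<bullet> z'" using assms by (simp add: norm_eq)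
    then have "2 * (z \<bullet> b) = b \<bullet> b" by (simp add: b_def inner_diff_left inner_diff_right inner_commute)
    then show ?thesis using False by (simp add: \<rho>_def k_def) (simp add: b_def)
  qed (simp add: \<rho>_def b_def)
  moreover have "\<rho> u = u" if "u \<bullet> z = 0" "u \<bullet> z' = 0" for u
    using that by (simp add: \<rho>_def k_def b_def inner_diff_right)
  ultimately show ?thesis using R by metis
qed

text \<open>The separation is written as \<rho> divided by M so that \<rho> can be chosen before the
  number M of rotations.\<close>

definition rotation_family :: "(real^'n) set \<Rightarrow> real^'n \<Rightarrow> real \<Rightarrow> nat \<Rightarrow> (nat \<Rightarrow> real^'n^'n) \<Rightarrow> bool" where
  "rotation_family S q \<rho> M R \<longleftrightarrow> (\<forall>m<M. orthogonal_matrix (R m) \<and> (\<forall>u\<in>S. R m *v u = u) \<and>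
    (\<forall>m'<M. m \<noteq> m' \<longrightarrow> \<rho> / real M \<le> norm (R m' *v q - R m *v q)))"

text \<open>Let \<open>z\<close> be the component of \<open>q\<close> orthogonal to
  \<open>span S\<close>. The dimension bound leaves a vector \<open>w\<close> orthogonal to
  \<open>S\<close> and \<open>q\<close>; scaled to the norm of \<open>z\<close>, it spans with
  \<open>z\<close> a circle of possible positions. Reflections taking \<open>z\<close> to points of
  this circle fix \<open>span S\<close>.\<close>

lemma separated_rotations:
  fixes S :: "(real^'n) set" and q :: "real^'n"
  assumes q: "q \<notin> span S" and dim: "dim (insert q S) < CARD('n)"
  shows "\<exists>\<rho>>0. \<forall>M>0. \<exists>R. rotation_family S q \<rho> M R"
proof -
  obtain y z where yz: "y \<in> span S" "\<And>w. w \<in> span S \<Longrightarrow> orthogonal z w" "q = y + z"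
    using orthogonal_subspace_decomp_exists[of S q] by metis
  have z0: "z \<noteq> 0" using q yz by auto
  have zspan: "z \<in> span (insert q S)"
  proof -
    have "z = q - y" using yz by simp
    then show ?thesis using yz(1) span_mono[of S "insert q S"] by (auto intro: span_diff span_base)
  qed
  obtain w' where w': "w' \<noteq> 0" "\<And>x. x \<in> span (insert q S) \<Longrightarrow> orthogonal w' x"
    using orthogonal_to_subspace_exists[of "insert q S"] dim by auto
  define w where "w = (norm z / norm w') *\<^sub>R w'"
  have w: "norm w = norm z" "w \<bullet> z = 0" "\<And>u. u \<in> span S \<Longrightarrow> u \<bullet> w = 0"
  proof -
    show "norm w = norm z" using w'(1) by (simp add: w_def)
    show "w \<bullet> z = 0" using w'(2)[OF zspan] by (simp add: w_def orthogonal_def)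
    fix u assume "u \<in> span S"
    then have "u \<in> span (insert q S)" using span_mono[of S "insert q S"] by auto
    then show "u \<bullet> w = 0" using w'(2)[of u] by (simp add: w_def orthogonal_def inner_commute)
  qed
  have zS: "u \<bullet> z = 0" if "u \<in> span S" for u using yz(2)[OF that] by (simp add: orthogonal_def inner_commute)
  have "\<exists>R. rotation_family S q (norm z) M R" if M: "M > 0" for M :: nat
  proof -
    define t where "t m = real m / real M" for m
    \<comment> \<open>Points of a quarter circle, spaced evenly in the \<open>w\<close> coordinate
      rather than in angle; their mutual distance is read off by pairing with
      \<open>w\<close>.\<close>
    define p where "p m = sqrt (1 - (t m)\<^sup>2) *\<^sub>R z + t m *\<^sub>R w" for m
    have np: "norm (p m) = norm z" if "m < M" for m
    proof -
      have "0 \<le> t m" "t m \<le> 1" using that M by (auto simp: t_def)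
      then have t: "(t m)\<^sup>2 \<le> 1" by (simp add: power_le_one)
      have "p m \<bullet> p m = (sqrt (1 - (t m)\<^sup>2))\<^sup>2 * (z \<bullet> z) + (t m)\<^sup>2 * (w \<bullet> w)"
        using w(2) by (simp add: p_def inner_add_left inner_add_right inner_commute power2_eq_square)
      also have "w \<bullet> w = z \<bullet> z" using w(1) by (simp add: norm_eq)
      also have "(sqrt (1 - (t m)\<^sup>2))\<^sup>2 * (z \<bullet> z) + (t m)\<^sup>2 * (z \<bullet> z) = z \<bullet> z"
        using t by (simp add: algebra_simps)
      finally show ?thesis by (simp add: norm_eq)
    qed
    have "\<exists>R. m < M \<longrightarrow> orthogonal_matrix R \<and> R *v z = p m \<and> (\<forall>u. u \<bullet> z = 0 \<longrightarrow> u \<bullet> p m = 0 \<longrightarrow> R *v u = u)" for m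
      using reflection_exists[of z "p m"] np[of m] by auto
    then obtain R where R: "\<And>m. m < M \<Longrightarrow> orthogonal_matrix (R m)" "\<And>m. m < M \<Longrightarrow> R m *v z = p m"
      "\<And>m u. m < M \<Longrightarrow> u \<bullet> z = 0 \<Longrightarrow> u \<bullet> p m = 0 \<Longrightarrow> R m *v u = u" by metis
    have fix_span: "R m *v u = u" if "m < M" "u \<in> span S" for m u
      using R(3)[OF that(1)] w(3)[OF that(2)] zS[OF that(2)] by (simp add: p_def inner_add_right)
    have Rq: "R m *v q = y + p m" if "m < M" for m
      using fix_span[OF that yz(1)] R(2)[OF that] by (simp add: yz(3) matrix_vector_right_distrib)
    have "norm z / real M \<le> norm (R m' *v q - R m *v q)" if m: "m < M" "m' < M" "m \<noteq> m'" for m m'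
    proof -
      have "1 \<le> \<bar>real m' - real m\<bar>" using m(3) by linarith
      then have "1 / real M \<le> \<bar>t m' - t m\<bar>"
        using M unfolding t_def diff_divide_distrib[symmetric] abs_divide by (simp add: divide_right_mono)
      then have "norm z / real M * norm w \<le> \<bar>t m' - t m\<bar> * norm w * norm w"
        using mult_right_mono[of "1 / real M" "\<bar>t m' - t m\<bar>" "norm w * norm w"] w(1) by simp
      also have "\<dots> = \<bar>(p m' - p m) \<bullet> w\<bar>"
        using w(2) by (simp add: p_def inner_diff_left inner_add_left inner_commute[of z] dot_square_norm power2_eq_square
            left_diff_distrib[symmetric] abs_mult)
      also have "\<dots> \<le> norm (p m' - p m) * norm w" by (rule Cauchy_Schwarz_ineq2)
      finally have "norm z / real M * norm w \<le> norm (p m' - p m) * norm w" .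
      then have "norm z / real M \<le> norm (p m' - p m)"
        by (rule mult_right_le_imp_le) (use z0 w(1) in simp)
      then show ?thesis using Rq m by simp
    qed
    then show ?thesis unfolding rotation_family_def using R(1) fix_span span_base by (metis (no_types, lifting))
  qed
  then show ?thesis using z0 by (intro exI[of _ "norm z"]) simp
qed

section \<open>Counting configurations\<close>

text \<open>Lowering one factor by \<open>D i\<close> costs at most
  \<open>b ^ (K - 1) * D i\<close>, as the other factors are at most \<open>b\<close>. For
  \<open>K = 0\<close> the truncated exponent is harmless, the sum being empty.\<close>

lemma prod_diff_lower_bound:
  fixes D :: "nat \<Rightarrow> real"
  assumes "\<And>i. i < K \<Longrightarrow> 0 \<le> D i" "\<And>i. i < K \<Longrightarrow> D i \<le> b"
  shows "b ^ K - b ^ (K - 1) * (\<Sum>i<K. D i) \<le> (\<Prod>i<K. b - D i)"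
  using assms
proof (induction K)
  case (Suc K)
  have b: "0 \<le> b" using Suc.prems[of 0] by (meson order_trans zero_less_Suc)
  have IH: "b ^ K - b ^ (K - 1) * (\<Sum>i<K. D i) \<le> (\<Prod>i<K. b - D i)" using Suc by simp
  have "(\<Prod>i<K. b - D i) \<le> (\<Prod>i<K. b)" using Suc.prems by (intro prod_mono) auto
  then have 1: "D K * (\<Prod>i<K. b - D i) \<le> D K * b ^ K" using Suc.prems by (intro mult_left_mono) auto
  have 2: "b * (b ^ K - b ^ (K - 1) * (\<Sum>i<K. D i)) \<le> b * (\<Prod>i<K. b - D i)"
    by (rule mult_left_mono[OF IH b])
  have 3: "b * (b ^ (K - 1) * (\<Sum>i<K. D i)) = b ^ K * (\<Sum>i<K. D i)"
    by (cases K) auto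
  have "b * b ^ K - b ^ K * (\<Sum>i<K. D i) \<le> b * (\<Prod>i<K. b - D i)"
    using 2 3 by (simp only: right_diff_distrib)
  then show ?case using 1 by (simp add: algebra_simps)
qed simp

text \<open>The factors are exchanged one at a time from the left, so in term \<open>j\<close> those
  before \<open>j\<close> come from \<open>p\<close> and those after it still from
  \<open>q\<close>.\<close>

lemma prod_diff_telescope:
  fixes p q :: "nat \<Rightarrow> real"
  shows "(\<Prod>i<K. p i) - (\<Prod>i<K. q i)
    = (\<Sum>j<K. (\<Prod>i\<in>{..<K} - {j}. if i < j then p i else q i) * (p j - q j))"
proof (induction K)
  case (Suc K)
  have 1: "(\<Prod>i\<in>{..<Suc K} - {j}. if i < j then p i else q i) = q K * (\<Prod>i\<in>{..<K} - {j}. if i < j then p i else q i)"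
    if "j < K" for j
  proof -
    have "{..<Suc K} - {j} = insert K ({..<K} - {j})" using that by auto
    then show ?thesis using that by simp
  qed
  have 2: "(\<Prod>i\<in>{..<Suc K} - {K}. if i < K then p i else q i) = (\<Prod>i<K. p i)"
    by (intro prod.cong) auto
  have "(\<Sum>j<Suc K. (\<Prod>i\<in>{..<Suc K} - {j}. if i < j then p i else q i) * (p j - q j))
     = q K * (\<Sum>j<K. (\<Prod>i\<in>{..<K} - {j}. if i < j then p i else q i) * (p j - q j)) + (\<Prod>i<K. p i) * (p K - q K)"
    using 1 2 by (simp add: sum_distrib_left mult.assoc)
  then show ?case using Suc by (simp add: algebra_simps)
qed simp


lemma admissible_prod:
  fixes k :: "'i \<Rightarrow> real^'n \<Rightarrow> real" and w :: "'i \<Rightarrow> real^'n"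
  assumes I: "finite I" "i0 \<in> I"
    and k: "\<And>i. i \<in> I \<Longrightarrow> k i \<in> borel_measurable borel" "\<And>i x. 0 \<le> k i x" "\<And>i x. k i x \<le> 1"
    and k0: "\<And>x. k i0 x \<noteq> 0 \<Longrightarrow> norm x \<le> r"
  shows "admissible e (\<lambda>a A x. \<Prod>i\<in>I. k i (x + (c * norm a) *\<^sub>R (A *v w i)))"
proof -
  have b: "\<bar>\<Prod>i\<in>J. k i (x + (c * norm a) *\<^sub>R (A *v w i))\<bar> \<le> 1" for a :: "real^'n" and A :: "real^'n^'n" and x J
    unfolding abs_prod using k by (intro prod_le_1) auto
  have "admissible e (\<lambda>a A x. k i0 (x + (c * norm a) *\<^sub>R (A *v w i0)))"
    by (rule admissible_base(1)[where B=1 and r=r]) (use k k0 I in auto)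
  then have "admissible e (\<lambda>a A x. k i0 (x + (c * norm a) *\<^sub>R (A *v w i0)) * (\<Prod>i\<in>I - {i0}. k i (x + (c * norm a) *\<^sub>R (A *v w i))))"
  proof (rule admissible_mult)
    show "(\<lambda>(a :: real^'n, A :: real^'n^'n, x). \<Prod>i\<in>I - {i0}. k i (x + (c * norm a) *\<^sub>R (A *v w i))) \<in> borel_measurable borel"
      by (rule config_prod_measurable) (use k in auto)
  qed (rule b)
  then show ?thesis by (simp only: prod.remove[OF I])
qed

section \<open>Main term and telescoped error\<close>

context unit_cube_function
begin

text \<open>An upper bound \<open>b\<close> close to the mean forces the average to be nearly
  \<open>b\<close> in L^1. The defect from \<open>b\<close> on a cube enlarged by \<tau> is
  nonnegative, and its integral is explicit because averaging preserves the integral of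
  \<open>f\<close>.\<close>

lemma config_int_cube_avg_lower:
  fixes v :: "nat \<Rightarrow> real^'n"
  assumes e: "0 < e" and c: "0 < c" and d\<tau>: "d \<le> \<tau>" and b: "\<And>y. cube_avg d f y \<le> b" and K: "0 < K"
    and v: "\<And>i. i < K \<Longrightarrow> c * 2 * ((1 + e) * norm (v i)) \<le> \<tau>"
  shows "(b ^ K - b ^ (K - 1) * (real K * (b * (1 + 2 * \<tau>) ^ CARD('n) - (\<integral>x. f x \<partial>lborel)))) * config_mass e TYPE('n)
    \<le> config_int e (\<lambda>a A x. \<Prod>i<K. cube_avg d f (x + (c * norm a) *\<^sub>R (A *v v i)))"
    (is "_ \<le> config_int e ?\<Phi>")
proof -
  define g where "g = cube_avg d f"
  define Z where "Z = config_mass e TYPE('n)"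
  let ?C = "cbox 0 (vec 1) :: (real^'n) set" and ?J = "cbox (vec (- \<tau>)) (vec (1 + \<tau>)) :: (real^'n) set"
  have g: "g \<in> borel_measurable borel" "0 \<le> g x" "g x \<le> 1" "g x \<le> b" "g x \<noteq> 0 \<Longrightarrow> norm x \<le> supp_radius" for x
    unfolding g_def by (auto simp: cube_avg_nonneg cube_avg_le_1 b norm_cube_avg_support)
  have b0: "0 \<le> b" using g(2,4) order_trans by blast
  have \<tau>: "0 < \<tau>" using d_pos d\<tau> by simp
  \<comment> \<open>The enlarged cube contains every vertex of a configuration based in the unit
    cube, and by \<open>d \<le> \<tau>\<close> also the support of \<open>g\<close>; hence
    \<open>D\<close> lies between 0 and \<open>b\<close>.\<close>
  define D where "D y = b * indicator ?J y - g y" for y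
  have gJ: "g y \<noteq> 0 \<Longrightarrow> y \<in> ?J" for y
  proof -
    assume "g y \<noteq> 0"
    then have *: "- d \<le> y $ i \<and> y $ i \<le> 1" for i
      using cube_avg_support[of y] by (simp add: g_def mem_box_cart)
    show "y \<in> ?J" using *[THEN conjunct1] *[THEN conjunct2] d\<tau> \<tau> unfolding mem_box_cart
      by (auto intro: order_trans[of "- \<tau>" "- d"] order_trans[of _ 1])
  qed
  have D: "0 \<le> D y" "D y \<le> b" for y
    using gJ[of y] g(2,4)[of y] b0 by (auto simp: D_def indicator_def)
  have Dm: "D \<in> borel_measurable borel" unfolding D_def[abs_def] using g(1) by measurable
  have Dr: "D y \<noteq> 0 \<Longrightarrow> norm y \<le> real CARD('n) * (1 + \<tau>)" for y
  proof -
    assume "D y \<noteq> 0"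
    then have "y \<in> ?J" using gJ[of y] by (cases "g y = 0") (auto simp: D_def indicator_def split: if_splits)
    then have "- \<tau> \<le> y $ i \<and> y $ i \<le> 1 + \<tau>" for i by (simp add: mem_box_cart)
    then have "\<bar>y $ i\<bar> \<le> 1 + \<tau>" for i using \<tau> by (smt (verit))
    then show ?thesis by (rule norm_le_cbox_cart)
  qed
  have intJ: "integrable lborel (indicator ?J :: real^'n \<Rightarrow> real)"
    by (intro integrable_real_indicator emeasure_cube_finite) simp
  have mJ: "measure lborel ?J = (1 + 2 * \<tau>) ^ CARD('n)"
    using \<tau> by (subst content_cbox_cart) (auto simp: interval_eq_empty_cart add.commute)
  have ID: "(\<integral>y. D y \<partial>lborel) = b * (1 + 2 * \<tau>) ^ CARD('n) - (\<integral>x. f x \<partial>lborel)"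
    unfolding D_def using intJ integrable_cube_avg by (simp add: g_def integral_cube_avg mJ)
  have adm\<Phi>: "admissible e ?\<Phi>"
    using admissible_prod[of "{..<K}" 0 "\<lambda>_. g" supp_radius e c v] g K by (simp add: g_def)
  let ?D = "\<lambda>i a A x. D (x + (c * norm a) *\<^sub>R (A *v v i))"
  have admD: "admissible e (?D i)" for i
    using admissible_base(1)[OF Dm _ Dr, of b] D by simp
  have Cr: "indicator ?C x \<noteq> (0::real) \<Longrightarrow> norm x \<le> real CARD('n) * 1" for x
    by (rule norm_le_cbox_cart) (auto simp: indicator_def mem_box_cart split: if_splits)
  have admC: "admissible e (\<lambda>a A x. indicator ?C x)"
    using admissible_base(1)[of "indicator ?C" 1 "real CARD('n) * 1" e 0 0] Cr by simp
  have admS: "admissible e (\<lambda>a A x. \<Sum>i<K. ?D i a A x)" by (intro admissible_sum admD) simp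
  let ?B = "\<lambda>a A x. b ^ K * indicator ?C x + (- (b ^ (K - 1))) * (\<Sum>i<K. ?D i a A x)"
  have "config_int e ?B = b ^ K * config_int e (\<lambda>a A x. indicator ?C x) + (- (b ^ (K - 1))) * config_int e (\<lambda>a A x. \<Sum>i<K. ?D i a A x)"
    by (simp only: config_int_add[OF admissible_cmult[OF admC] admissible_cmult[OF admS]] config_int_cmult)
  also have "config_int e (\<lambda>a A x. indicator ?C x) = 1 * Z"
    unfolding Z_def using measure_cube[of 1, where 'n='n] by (intro config_int_const[OF admC]) simp
  also have "config_int e (\<lambda>a A x. \<Sum>i<K. ?D i a A x) = (\<Sum>i<K. (\<integral>y. D y \<partial>lborel) * Z)"
  proof -
    have "config_int e (?D i) = (\<integral>y. D y \<partial>lborel) * Z" for i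
      unfolding Z_def by (rule config_int_const[OF admD]) (rule integral_lborel_translation[OF Dm])
    then show ?thesis by (subst config_int_sum) (simp_all add: admD)
  qed
  finally have eqB: "config_int e ?B
      = (b ^ K - b ^ (K - 1) * (real K * (b * (1 + 2 * \<tau>) ^ CARD('n) - (\<integral>x. f x \<partial>lborel)))) * Z"
    by (simp add: ID algebra_simps)
  have "config_int e ?B \<le> config_int e ?\<Phi>"
  proof (rule config_int_mono)
    show "admissible e ?B" by (intro admissible_add admissible_cmult admC admS)
    show "admissible e ?\<Phi>" by (rule adm\<Phi>)
  next
    fix a :: "real^'n" and A :: "real^'n^'n" and x
    assume a: "bump a \<noteq> 0" and A: "A \<in> near_iso e"
    show "?B a A x \<le> ?\<Phi> a A x"
    proof (cases "x \<in> ?C")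
      case True
      have eq: "cube_avg d f (x + (c * norm a) *\<^sub>R (A *v v i)) = b - ?D i a A x" if i: "i < K" for i
      proof -
        let ?s = "(c * norm a) *\<^sub>R (A *v v i)"
        have "norm ?s = (c * norm a) * norm (A *v v i)" using c by simp
        also have "\<dots> \<le> (c * 2) * ((1 + e) * norm (v i))"
          using bump_support[OF a] norm_near_iso(1)[OF A, of "v i"] c by (intro mult_mono mult_left_mono) auto
        finally have "norm ?s \<le> \<tau>" using v[OF i] by simp
        then have s: "\<bar>?s $ j\<bar> \<le> \<tau>" for j using component_le_norm_cart[of ?s j] by simp
        have x01: "0 \<le> x $ j \<and> x $ j \<le> 1" for j using True by (simp add: mem_box_cart)
        have "- \<tau> \<le> (x + ?s) $ j \<and> (x + ?s) $ j \<le> 1 + \<tau>" for j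
          using s[of j] x01[of j] unfolding vector_add_component by linarith
        then have "x + ?s \<in> ?J" by (simp only: mem_box_cart vec_component) simp
        then show ?thesis by (simp add: D_def g_def)
      qed
      have "?\<Phi> a A x = (\<Prod>i<K. b - ?D i a A x)" using eq by simp
      then show ?thesis using prod_diff_lower_bound[of K "\<lambda>i. ?D i a A x" b] D True by simp
    next
      \<comment> \<open>For \<open>x\<close> outside the unit cube the minorant is at most 0 while
        the product is nonnegative.\<close>
      case False
      have "0 \<le> b ^ (K - 1) * (\<Sum>i<K. ?D i a A x)" using b0 D by (intro mult_nonneg_nonneg sum_nonneg) auto
      moreover have "0 \<le> ?\<Phi> a A x" using cube_avg_nonneg by (intro prod_nonneg) auto
      ultimately show ?thesis using False by simp
    qed
  qed
  then show ?thesis unfolding eqB Z_def .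
qed

text \<open>Each telescoping term contains a single factor \<open>dev\<close>, at vertex
  \<open>j\<close>. Translating another vertex \<open>i0\<close> to the origin brings it into the
  form of \<open>config_term_bound\<close>.\<close>

lemma config_int_telescope:
  fixes v :: "nat \<Rightarrow> real^'n"
  assumes e: "0 < e" "e \<le> 1/2" and c: "0 < c" and K: "2 \<le> K" and M: "0 < M" and \<rho>: "0 < \<rho>" and th: "0 < \<theta>"
    and rot: "\<And>j i0. j < K \<Longrightarrow> i0 < K \<Longrightarrow> i0 \<noteq> j \<Longrightarrow> 
      \<exists>R. rotation_family ((\<lambda>i. v i - v i0) ` ({..<K} - {j})) (v j - v i0) \<rho> M R"
  defines "Z \<equiv> config_mass e TYPE('n)" and "G \<equiv> measure lborel (near_iso e :: (real^'n^'n) set)"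
  shows "config_int e (\<lambda>a A x. \<Prod>i<K. cube_avg d f (x + (c * norm a) *\<^sub>R (A *v v i)))
    \<le> config_int e (\<lambda>a A x. \<Prod>i<K. f (x + (c * norm a) *\<^sub>R (A *v v i)))
      + real K * (\<theta> / 2 * Z + 1 / (2 * \<theta>) * (2 * Z / real M + 2 * G * (osc_const TYPE('n) * d / (c * (\<rho> / real M)))))"
proof -
  define E where "E = \<theta> / 2 * Z + 1 / (2 * \<theta>) * (2 * Z / real M + 2 * G * (osc_const TYPE('n) * d / (c * (\<rho> / real M))))"
  let ?g = "cube_avg d f"
  let ?p = "\<lambda>i a A x. x + (c * norm a) *\<^sub>R (A *v v i)"
  define k where "k j i = (if i < j then f else ?g)" for i j :: nat
  have k: "k j i \<in> borel_measurable borel" "0 \<le> k j i x" "k j i x \<le> 1" "k j i x \<noteq> 0 \<Longrightarrow> norm x \<le> supp_radius"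
    "(\<integral>x. k j i x \<partial>lborel) \<le> 1" for i j x
    using f_nonneg f_le_1 cube_avg_nonneg cube_avg_le_1 norm_f_support'[of x] norm_cube_avg_support[of x]
      integral_f_le_1 integral_cube_avg
    by (cases "i < j"; simp add: k_def)+
  let ?T = "\<lambda>j a A x. (\<Prod>i\<in>{..<K} - {j}. k j i (?p i a A x)) * dev (?p j a A x)"
  have I: "\<exists>i0. i0 \<in> {..<K} - {j}" if "j < K" for j
    \<comment> \<open>\<open>K\<close> at least 2 provides a vertex other than \<open>j\<close> to
      serve as origin.\<close>
    using K by (intro exI[of _ "if j = 0 then 1 else 0"]) auto
  have admT: "admissible e (\<lambda>a A x. (\<Prod>i\<in>{..<K} - {j}. k j i (x + (c * norm a) *\<^sub>R (A *v u i))) * dev (x + (c * norm a) *\<^sub>R (A *v q)))"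
    if j: "j < K" for j u q
  proof (rule admissible_mult)
    obtain i0 where i0: "i0 \<in> {..<K} - {j}" using I[OF j] by blast
    show "admissible e (\<lambda>a A x. \<Prod>i\<in>{..<K} - {j}. k j i (x + (c * norm a) *\<^sub>R (A *v u i)))"
      by (rule admissible_prod[OF _ i0, where r=supp_radius]) (use k in auto)
    show "(\<lambda>(a :: real^'n, A :: real^'n^'n, x). dev (x + (c * norm a) *\<^sub>R (A *v q))) \<in> borel_measurable borel"
      by (rule admissible_base(2)[OF dev_measurable abs_dev_le_1 norm_dev_support])
  qed (rule abs_dev_le_1)
  have T: "- config_int e (?T j) \<le> E" if j: "j < K" for j
  proof -
    obtain i0 where i0: "i0 \<in> {..<K} - {j}" using I[OF j] by blast
    then obtain R where R: "rotation_family ((\<lambda>i. v i - v i0) ` ({..<K} - {j})) (v j - v i0) \<rho> M R"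
      using rot[OF j, of i0] by auto
    let ?T' = "\<lambda>a A x. (\<Prod>i\<in>{..<K} - {j}. k j i (x + (c * norm a) *\<^sub>R (A *v (v i - v i0)))) * dev (x + (c * norm a) *\<^sub>R (A *v (v j - v i0)))"
    have "config_int e (?T j) = config_int e ?T'"
      by (rule config_int_translate[OF admT[OF j] admT[OF j], where s="\<lambda>a A. (c * norm a) *\<^sub>R (A *v v i0)"])
         (simp add: matrix_vector_mult_diff_distrib scaleR_diff_right)
    moreover have "\<bar>config_int e ?T'\<bar> \<le> E"
      unfolding E_def Z_def G_def
      by (rule config_term_bound[OF e c th _ M _ i0, where R=R and r=supp_radius])
         (use R k M \<rho> in \<open>auto simp: rotation_family_def norm_minus_commute\<close>)
    ultimately show ?thesis by linarith
  qed
  have adm: "admissible e (\<lambda>a A x. \<Prod>i<K. k j i (?p i a A x))" for j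
    by (rule admissible_prod[where ?i0.0=0 and r=supp_radius]) (use K k in auto)
  have admg: "admissible e (\<lambda>a A x. \<Prod>i<K. ?g (?p i a A x))" using adm[of 0] by (simp add: k_def)
  have admf: "admissible e (\<lambda>a A x. \<Prod>i<K. f (?p i a A x))" 
  proof -
    have "(\<lambda>(a :: real^'n) (A :: real^'n^'n) x. \<Prod>i<K. k K i (?p i a A x)) = (\<lambda>a A x. \<Prod>i<K. f (?p i a A x))"
      by (intro ext prod.cong) (auto simp: k_def)
    then show ?thesis using adm[of K] by simp
  qed
  have "(\<Prod>i<K. f (?p i a A x)) = (\<Prod>i<K. ?g (?p i a A x)) + (\<Sum>j<K. ?T j a A x)"
    for a :: "real^'n" and A :: "real^'n^'n" and x
    using prod_diff_telescope[of "\<lambda>i. f (?p i a A x)" K "\<lambda>i. ?g (?p i a A x)"]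
    by (simp add: k_def dev_def if_distrib[of "\<lambda>h. h _"] cong: if_cong)
  then have "config_int e (\<lambda>a A x. \<Prod>i<K. f (?p i a A x))
      = config_int e (\<lambda>a A x. (\<Prod>i<K. ?g (?p i a A x)) + (\<Sum>j<K. ?T j a A x))" by simp
  also have "\<dots> = config_int e (\<lambda>a A x. \<Prod>i<K. ?g (?p i a A x)) + (\<Sum>j<K. config_int e (?T j))"
    using config_int_add[OF admg admissible_sum[of "{..<K}" e ?T]] config_int_sum[of "{..<K}" e ?T] admT by simp
  finally have "config_int e (\<lambda>a A x. \<Prod>i<K. ?g (?p i a A x))
      = config_int e (\<lambda>a A x. \<Prod>i<K. f (?p i a A x)) + (\<Sum>j<K. - config_int e (?T j))"
    by (simp add: sum_negf)
  also have "(\<Sum>j<K. - config_int e (?T j)) \<le> real K * E"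
    using sum_bounded_above[of "{..<K}" "\<lambda>j. - config_int e (?T j)" E] T by simp
  finally show ?thesis unfolding E_def by simp
qed

end

section \<open>Density increment\<close>

lemma orthogonal_matrix_norm_preserving:
  fixes A :: "real^'n^'n"
  assumes "\<And>x. norm (A *v x) = norm x"
  shows "orthogonal_matrix A"
proof -
  have "orthogonal_transformation ((*v) A)" using assms by (simp add: orthogonal_transformation)
  then show ?thesis by (simp add: orthogonal_transformation_matrix)
qed

text \<open>A nested sequence of nonempty compact sets has a common point. A matrix that is a
  near-isometry for every tolerance preserves norms exactly.\<close>

lemma exact_copy_of_near_copies:
  fixes v :: "nat \<Rightarrow> real^'n" and E :: "(real^'n) set"
  assumes E: "compact E" and c: "0 < c" and K: "0 < K"
    and near: "\<And>k::nat. \<exists>a A x. bump (a :: real^'n) \<noteq> 0 \<and> A \<in> near_iso (1 / real (k + 2)) \<and>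
      (\<forall>i<K. x + (c * norm a) *\<^sub>R (A *v v i) \<in> E)"
  shows "\<exists>x U r. orthogonal_matrix U \<and> c \<le> r \<and> (\<forall>i<K. x + r *\<^sub>R (U *v v i) \<in> E)"
proof -
  \<comment> \<open>Only the dilation \<open>c * norm a\<close> is kept from \<open>a\<close>; it
    lies in the compact interval from \<open>c\<close> to \<open>2 * c\<close>. The position
    \<open>x\<close> is bounded because vertex 0 lands in the bounded set \<open>E\<close>.\<close>
  define F :: "nat \<Rightarrow> (real \<times> (real^'n^'n) \<times> (real^'n)) set" where
    "F k = ({c..2 * c} \<times> near_iso (1 / real (k + 2)) \<times> UNIV) \<inter>
      (\<Inter>i<K. (\<lambda>z. snd (snd z) + fst z *\<^sub>R (fst (snd z) *v v i)) -` E)" for k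
  obtain B where B: "\<And>y. y \<in> E \<Longrightarrow> norm y \<le> B"
    using compact_imp_bounded[OF E] by (auto simp: bounded_iff)
  have "compact (F k)" for k
    unfolding compact_eq_bounded_closed
  proof
    let ?r = "(1 + 1 / real (k + 2)) * real CARD('n) * real CARD('n)"
    let ?s = "B + 2 * c * ((1 + 1 / real (k + 2)) * norm (v 0))"
    have "norm z \<le> 2 * c + (?r + ?s)" if z: "z \<in> F k" for z
    proof -
      obtain r A x where zz: "z = (r, A, x)" by (cases z) auto
      have r: "0 \<le> r" "r \<le> 2 * c" and A: "A \<in> near_iso (1 / real (k + 2))"
        and "x + r *\<^sub>R (A *v v 0) \<in> E"
        using z c K by (auto simp: F_def zz)
      then have 1: "norm (x + r *\<^sub>R (A *v v 0)) \<le> B" using B by blast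
      have 2: "norm (r *\<^sub>R (A *v v 0)) \<le> 2 * c * ((1 + 1 / real (k + 2)) * norm (v 0))"
        using r norm_near_iso(1)[OF A, of "v 0"] unfolding norm_scaleR by (intro mult_mono) auto
      have "norm x \<le> ?s"
        using norm_triangle_ineq4[of "x + r *\<^sub>R (A *v v 0)" "r *\<^sub>R (A *v v 0)"] 1 2 by simp
      then show ?thesis
        using near_iso_bounded[OF A] r norm_Pair_le[of r "(A, x)"] norm_Pair_le[of A x] unfolding zz by simp
    qed
    then show "bounded (F k)" unfolding bounded_iff by blast
    have "closed ((\<lambda>z. snd (snd z) + fst z *\<^sub>R (fst (snd z) *v v i)) -` E)" for i
      by (intro closed_vimage compact_imp_closed[OF E] continuous_intros)
    then show "closed (F k)"
      unfolding F_def by (intro closed_Int closed_Times closed_INT ballI closed_near_iso) auto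
  qed
  moreover have "F k \<noteq> {}" for k
  proof -
    obtain a :: "real^'n" and A x where a: "bump a \<noteq> 0" and A: "A \<in> near_iso (1 / real (k + 2))"
      and x: "\<forall>i<K. x + (c * norm a) *\<^sub>R (A *v v i) \<in> E" using near by blast
    have "(c * norm a, A, x) \<in> F k"
      using bump_support[OF a] A x c by (auto simp: F_def mult.commute)
    then show ?thesis by blast
  qed
  moreover have "F n \<subseteq> F m" if "m \<le> n" for m n
  proof -
    have "1 / real (n + 2) \<le> 1 / real (m + 2)" using that by (intro divide_left_mono) auto
    then have "near_iso (1 / real (n + 2)) \<subseteq> (near_iso (1 / real (m + 2)) :: (real^'n^'n) set)"
      unfolding near_iso_def by (blast intro: order_trans mult_right_mono norm_ge_zero)
    then show ?thesis unfolding F_def by blast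
  qed
  ultimately have "\<Inter> (range F) \<noteq> {}" by (rule compact_nest)
  then obtain r A x where rAx: "\<And>k. (r, A, x) \<in> F k" by (metis (no_types, lifting) INT_E UNIV_I ex_in_conv prod_cases3)
  have "norm (A *v y) = norm y" for y
  proof -
    have "\<bar>norm (A *v y) - norm y\<bar> \<le> 1 / real (k + 2) * norm y" for k
      using rAx[of k] by (auto simp: F_def near_iso_def)
    moreover have "(\<lambda>k. 1 / real (k + 2) * norm y) \<longlonglongrightarrow> 0 * norm y"
      by (intro tendsto_mult tendsto_const LIMSEQ_ignore_initial_segment[OF lim_1_over_n])
    ultimately have "\<bar>norm (A *v y) - norm y\<bar> \<le> 0 * norm y"
      by (intro LIMSEQ_le_const) auto
    then show ?thesis by simp
  qed
  then have "orthogonal_matrix A" by (rule orthogonal_matrix_norm_preserving)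
  moreover have "c \<le> r" "\<forall>i<K. x + r *\<^sub>R (A *v v i) \<in> E" using rAx[of 0] by (auto simp: F_def)
  ultimately show ?thesis by blast
qed

section \<open>The dichotomy for a fixed lower bound on the density\<close>

lemma cube_avg_indicator:
  fixes E :: "(real^'n) set"
  assumes [measurable]: "E \<in> sets borel"
  shows "cube_avg d (indicator E) y = measure lborel (E \<inter> cbox y (y + vec d)) / d ^ CARD('n)"
proof -
  have eq: "indicator (cbox 0 (vec d)) u * indicator E (y + u) = (indicator (E \<inter> cbox y (y + vec d)) (u + y) :: real)" for u
    by (auto simp: indicator_def mem_box_cart add.commute)
  have "(\<integral>u. indicator (cbox 0 (vec d)) u * indicator E (y + u) \<partial>lborel) = (\<integral>u. (indicator (E \<inter> cbox y (y + vec d)) u :: real) \<partial>(lborel :: (real^'n) measure))"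
    unfolding eq by (rule integral_lborel_translation) (intro borel_measurable_indicator sets.Int, auto)
  then show ?thesis by (simp add: cube_avg_def)
qed

text \<open>Decreasing \<rho> only weakens the separation, so the minimum over the finitely many
  pairs of vertices works for all.\<close>

lemma uniform_separated_rotations:
  fixes v :: "nat \<Rightarrow> real^'n"
  assumes K: "K < CARD('n)"
    and ind: "\<And>j i0. j < K \<Longrightarrow> i0 < K \<Longrightarrow> i0 \<noteq> j \<Longrightarrow> v j - v i0 \<notin> span ((\<lambda>i. v i - v i0) ` ({..<K} - {j}))"
  shows "\<exists>\<rho>>0. \<forall>j<K. \<forall>i0<K. i0 \<noteq> j \<longrightarrow>
    (\<forall>M>0. \<exists>R. rotation_family ((\<lambda>i. v i - v i0) ` ({..<K} - {j})) (v j - v i0) \<rho> M R)"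
proof -
  let ?S = "\<lambda>j i0. (\<lambda>i. v i - v i0) ` ({..<K} - {j})"
  let ?P = "\<lambda>j i0 \<rho>. \<forall>M>0. \<exists>R. rotation_family (?S j i0) (v j - v i0) \<rho> M R"
  have ex: "\<exists>\<rho>>0. (j < K \<and> i0 < K \<and> i0 \<noteq> j \<longrightarrow> ?P j i0 \<rho>)" for j i0
  proof (cases "j < K \<and> i0 < K \<and> i0 \<noteq> j")
    case True
    have eq: "insert (v j - v i0) (?S j i0) = (\<lambda>i. v i - v i0) ` {..<K}" using True by auto
    have "dim ((\<lambda>i. v i - v i0) ` {..<K}) \<le> card ((\<lambda>i. v i - v i0) ` {..<K})" by (intro dim_le_card') auto
    also have "\<dots> \<le> K" using card_image_le[of "{..<K}" "\<lambda>i. v i - v i0"] by simp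
    finally have "dim (insert (v j - v i0) (?S j i0)) < CARD('n)" unfolding eq using K by simp
    from separated_rotations[OF ind[of j i0] this] True show ?thesis by auto
  qed (auto intro: exI[of _ 1])
  then obtain r where r: "\<And>j i0. r j i0 > (0::real)" "\<And>j i0. j < K \<Longrightarrow> i0 < K \<Longrightarrow> i0 \<noteq> j \<Longrightarrow> ?P j i0 (r j i0)"
    by metis
  define \<rho> where "\<rho> = Min (insert 1 ((\<lambda>(j, i0). r j i0) ` ({..<K} \<times> {..<K})))"
  have \<rho>0: "\<rho> > 0" unfolding \<rho>_def using r(1) by (subst Min_gr_iff) auto
  have "?P j i0 \<rho>" if j: "j < K" "i0 < K" "i0 \<noteq> j" for j i0
  proof (intro allI impI)
    fix M :: nat assume M: "M > 0"
    then obtain R where R: "rotation_family (?S j i0) (v j - v i0) (r j i0) M R"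
      using r(2)[OF j] by blast
    have "\<rho> \<le> r j i0" unfolding \<rho>_def using j by (intro Min_le) auto
    then have "\<rho> / real M \<le> r j i0 / real M" by (simp add: divide_right_mono)
    then show "\<exists>R. rotation_family (?S j i0) (v j - v i0) \<rho> M R"
      using R unfolding rotation_family_def by (blast intro: order_trans)
  qed
  then show ?thesis using \<rho>0 by blast
qed

text \<open>The constants are chosen before \<alpha> and \<open>E\<close>, and the cube side depends
  on \<alpha> but not on the actual measure of \<open>E\<close>; this allows every step of the
  iteration to use the same side.\<close>

lemma density_dichotomy:
  fixes v :: "nat \<Rightarrow> real^'n"
  assumes K: "2 \<le> K" "K < CARD('n)"
    and ind: "\<And>j i0. j < K \<Longrightarrow> i0 < K \<Longrightarrow> i0 \<noteq> j \<Longrightarrow> v j - v i0 \<notin> span ((\<lambda>i. v i - v i0) ` ({..<K} - {j}))"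
  shows "\<exists>\<eta>>0. \<exists>c1>0. \<exists>c>0. c1 \<le> 1 \<and> c \<le> 1 \<and>
    (\<forall>\<alpha> E. 0 < \<alpha> \<longrightarrow> \<alpha> \<le> 1 \<longrightarrow> compact E \<longrightarrow> E \<subseteq> cbox 0 (vec 1) \<longrightarrow> \<alpha> \<le> measure lborel E \<longrightarrow>
      (\<exists>x U r. orthogonal_matrix U \<and> c \<le> r \<and> (\<forall>i<K. x + r *\<^sub>R (U *v v i) \<in> E)) \<or>
      (\<exists>y. (1 + \<eta>) * measure lborel E * (c1 * \<alpha> ^ (4 * K)) ^ CARD('n)
        \<le> measure lborel (E \<inter> cbox y (y + vec (c1 * \<alpha> ^ (4 * K))))))"
proof -
  have "\<exists>\<rho>>0. \<forall>j<K. \<forall>i0<K. i0 \<noteq> j \<longrightarrow>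
    (\<forall>M>0. \<exists>R. rotation_family ((\<lambda>i. v i - v i0) ` ({..<K} - {j})) (v j - v i0) \<rho> M R)"
    by (rule uniform_separated_rotations[OF K(2)]) (rule ind)
  then obtain \<rho> where \<rho>: "\<rho> > 0" and rot: "\<And>j i0 M. j < K \<Longrightarrow> i0 < K \<Longrightarrow> i0 \<noteq> j \<Longrightarrow> M > 0 \<Longrightarrow>
    \<exists>R. rotation_family ((\<lambda>i. v i - v i0) ` ({..<K} - {j})) (v j - v i0) \<rho> M R"
    by blast
  \<comment> \<open>With \<open>real K * \<eta> = 1/4\<close> the loss in the main term, at most
    \<open>2 * real K * \<eta> * b ^ K\<close>, is half of \<open>b ^ K\<close>.\<close>
  define \<eta> where "\<eta> = 1 / (4 * real K)"
  have \<eta>: "0 < \<eta>" "real K * \<eta> = 1/4" "\<eta> \<le> 1" using K by (auto simp: \<eta>_def)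
  \<comment> \<open>Enlarging the unit cube by \<tau> on every side multiplies its volume by exactly
    \<open>1 + \<eta>\<close>.\<close>
  define \<tau> where "\<tau> = (root CARD('n) (1 + \<eta>) - 1) / 2"
  have \<tau>: "0 < \<tau>" "(1 + 2 * \<tau>) ^ CARD('n) = 1 + \<eta>"
  proof -
    show "0 < \<tau>" using \<eta> real_root_gt_1_iff[of "CARD('n)" "1 + \<eta>"] by (simp add: \<tau>_def)
    have "1 + 2 * ((x - 1) / 2) = x" for x :: real by argo
    then have "1 + 2 * \<tau> = root CARD('n) (1 + \<eta>)" unfolding \<tau>_def .
    then show "(1 + 2 * \<tau>) ^ CARD('n) = 1 + \<eta>" using \<eta> by (simp only:) (rule real_root_pow_pos2, auto)
  qed
  define V where "V = (\<Sum>i<K. norm (v i))"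
  have V: "norm (v i) \<le> V" if "i < K" for i
    unfolding V_def using that by (intro member_le_sum) auto
  have V0: "0 \<le> V" unfolding V_def by (intro sum_nonneg) auto
  \<comment> \<open>Vertices move by at most \<open>c * 2 * (1 + e) * V\<close> with
    \<open>e \<le> 1/2\<close>, whence the 3. The summand 1 keeps the denominator positive.\<close>
  define c where "c = min 1 (\<tau> / (3 * (1 + V)))"
  have c: "0 < c" "c \<le> 1" "c * 3 * (1 + V) \<le> \<tau>"
  proof -
    show "0 < c" "c \<le> 1" using \<tau> V0 by (auto simp: c_def)
    have "c \<le> \<tau> / (3 * (1 + V))" by (simp add: c_def)
    then show "c * 3 * (1 + V) \<le> \<tau>" using V0 by (simp add: field_simps)
  qed
  define w0 where "w0 = (\<integral>a. bump a \<partial>(lborel :: (real^'n) measure))"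
  have w0: "0 < w0" unfolding w0_def by (rule integral_bump_pos)
  let ?o = "osc_const TYPE('n)"
  have o: "0 \<le> ?o" by (rule osc_const_nonneg)
  \<comment> \<open>The last entry makes the off-diagonal error at most
    \<open>\<theta>\<^sup>2 / 2 * Z\<close>: with M at most \<open>5 / \<theta>\<^sup>2\<close>, the
    denominator 20 leaves \<open>w0 * \<theta>\<^sup>2 / 4\<close>, which is then multiplied by
    \<open>2 * G\<close>. Adding 1 to the oscillation constant avoids a zero denominator.\<close>
  define c1 where "c1 = min 1 (min \<tau> (c * \<rho> * w0 * \<eta> ^ 4 / (20 * (?o + 1))))"
  have c1: "0 < c1" "c1 \<le> 1" "c1 \<le> \<tau>" "c1 \<le> c * \<rho> * w0 * \<eta> ^ 4 / (20 * (?o + 1))"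
    using \<tau> c \<rho> w0 \<eta> o by (auto simp: c1_def)
  have main: "(\<exists>x U r. orthogonal_matrix U \<and> c \<le> r \<and> (\<forall>i<K. x + r *\<^sub>R (U *v v i) \<in> E)) \<or>
      (\<exists>y. (1 + \<eta>) * measure lborel E * (c1 * \<alpha> ^ (4 * K)) ^ CARD('n)
        \<le> measure lborel (E \<inter> cbox y (y + vec (c1 * \<alpha> ^ (4 * K)))))"
    if \<alpha>: "0 < \<alpha>" "\<alpha> \<le> 1" and E: "compact E" "E \<subseteq> cbox 0 (vec 1)" "\<alpha> \<le> measure lborel E" for \<alpha> and E :: "(real^'n) set"
  proof (rule ccontr)
    assume neg: "\<not> ?thesis"
    define d where "d = c1 * \<alpha> ^ (4 * K)"
    define \<beta> where "\<beta> = measure lborel E"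
    define b where "b = (1 + \<eta>) * \<beta>"
    \<comment> \<open>The error allowed per vertex, relative to the total mass; the K vertices
      together lose \<open>\<alpha> ^ K / 4\<close>.\<close>
    define \<theta> where "\<theta> = \<eta> * \<alpha> ^ K"
    have \<alpha>K: "0 < \<alpha> ^ K" "\<alpha> ^ K \<le> 1" using \<alpha> by (auto simp: power_le_one)
    have \<theta>: "0 < \<theta>" "\<theta> \<le> 1" "real K * \<theta> = \<alpha> ^ K / 4"
      using \<eta> \<alpha>K by (auto simp: \<theta>_def mult_le_one)
    have d: "0 < d" "d \<le> \<tau>" "d \<le> c * \<rho> * w0 * \<theta> ^ 4 / (20 * (?o + 1))"
    proof -
      show "0 < d" using c1 \<alpha> by (simp add: d_def)
      have "d \<le> c1 * 1" unfolding d_def using c1 \<alpha> by (intro mult_left_mono power_le_one) auto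
      then show "d \<le> \<tau>" using c1 by simp
      have "d \<le> c * \<rho> * w0 * \<eta> ^ 4 / (20 * (?o + 1)) * \<alpha> ^ (4 * K)"
        unfolding d_def using c1 \<alpha> by (intro mult_right_mono) auto
      also have "\<dots> = c * \<rho> * w0 * \<theta> ^ 4 / (20 * (?o + 1))"
        by (simp add: \<theta>_def power_mult_distrib power_mult[symmetric] mult.commute)
      finally show "d \<le> c * \<rho> * w0 * \<theta> ^ 4 / (20 * (?o + 1))" .
    qed
    have Eb [measurable]: "E \<in> sets borel" using E(1) by (simp add: compact_imp_closed)
    interpret unit_cube_function "indicator E :: real^'n \<Rightarrow> real" d
    proof
      show "indicator E x \<noteq> (0::real) \<Longrightarrow> x \<in> cbox 0 (vec 1)" for x
        using E(2) by (auto simp: indicator_def split: if_splits)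
    qed (auto simp: d(1) indicator_def)
    have gb: "cube_avg d (indicator E) y \<le> b" for y
    proof -
      have "measure lborel (E \<inter> cbox y (y + vec d)) \<le> b * d ^ CARD('n)"
        using neg unfolding b_def \<beta>_def d_def by (meson less_imp_le not_le)
      then show ?thesis using d by (simp add: cube_avg_indicator pos_divide_le_eq)
    qed
    have "\<not> (\<forall>k. \<exists>a A x. bump (a :: real^'n) \<noteq> 0 \<and> A \<in> near_iso (1 / real (k + 2)) \<and>
      (\<forall>i<K. x + (c * norm a) *\<^sub>R (A *v v i) \<in> E))"
    proof
      assume all: "\<forall>k. \<exists>a A x. bump (a :: real^'n) \<noteq> 0 \<and> A \<in> near_iso (1 / real (k + 2)) \<and>
        (\<forall>i<K. x + (c * norm a) *\<^sub>R (A *v v i) \<in> E)"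
      have "0 < K" using K by simp
      from exact_copy_of_near_copies[OF E(1) c(1) this all[rule_format]] neg show False by blast
    qed
    then obtain k where k: "\<And>a A x. bump (a :: real^'n) \<noteq> 0 \<Longrightarrow> A \<in> near_iso (1 / real (k + 2)) \<Longrightarrow>
      \<exists>i<K. x + (c * norm a) *\<^sub>R (A *v v i) \<notin> E" by blast
    \<comment> \<open>The tolerance comes from compactness and is not quantitative, which is
      harmless as no constant above depends on it. The offset 2 ensures
      \<open>e \<le> 1/2\<close>.\<close>
    define e where "e = 1 / real (k + 2)"
    have e: "0 < e" "e \<le> 1/2" by (auto simp: e_def field_simps)
    define Z where "Z = config_mass e TYPE('n)"
    define G where "G = measure lborel (near_iso e :: (real^'n^'n) set)"
    have Z: "0 < Z" "Z = w0 * G" unfolding Z_def w0_def G_def by (rule config_mass_pos[OF e(1)]) (simp add: config_mass_def)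
    have G: "0 < G" unfolding G_def by (rule near_iso_measure_pos[OF e(1)])
    have zero: "config_int e (\<lambda>a A x. \<Prod>i<K. indicator E (x + (c * norm a) *\<^sub>R (A *v v i))) = 0"
    proof -
      have "bump a * indicator (near_iso e) A * (\<Prod>i<K. indicator E (x + (c * norm a) *\<^sub>R (A *v v i))) = (0::real)"
        for a :: "real^'n" and A :: "real^'n^'n" and x
      proof (cases "bump a \<noteq> 0 \<and> A \<in> near_iso e")
        case True
        then obtain i where "i < K" "x + (c * norm a) *\<^sub>R (A *v v i) \<notin> E" using k[of a A x] unfolding e_def by blast
        then have "(\<Prod>i<K. indicator E (x + (c * norm a) *\<^sub>R (A *v v i))) = (0::real)"
          by (intro prod_zero) (auto simp: indicator_def)
        then show ?thesis by simp
      qed auto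
      then show ?thesis unfolding config_int_def by (simp only: case_prod_unfold) simp
    qed
    \<comment> \<open>The lower bound \<open>4 / \<theta>\<^sup>2\<close> makes the diagonal error
      \<open>2 * Z / real M\<close> at most \<open>\<theta>\<^sup>2 / 2 * Z\<close>; rounding up
      costs little because \<open>\<theta> \<le> 1\<close>.\<close>
    define M where "M = nat \<lceil>4 / \<theta>\<^sup>2\<rceil>"
    have \<theta>2: "0 < \<theta>\<^sup>2" "\<theta>\<^sup>2 \<le> 1" using \<theta> by (auto simp: power_le_one)
    have M: "4 / \<theta>\<^sup>2 \<le> real M" "real M \<le> 5 / \<theta>\<^sup>2" "0 < M"
    proof -
      have p: "0 < 4 / \<theta>\<^sup>2" using \<theta>2 by simp
      show 1: "4 / \<theta>\<^sup>2 \<le> real M" unfolding M_def by linarith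
      have "real M \<le> 4 / \<theta>\<^sup>2 + 1" unfolding M_def using p by linarith
      also have "\<dots> \<le> 4 / \<theta>\<^sup>2 + 1 / \<theta>\<^sup>2" by (rule add_left_mono) (use \<theta>2 in \<open>simp add: le_divide_eq\<close>)
      also have "\<dots> = 5 / \<theta>\<^sup>2" by (simp add: add_divide_distrib[symmetric])
      finally show "real M \<le> 5 / \<theta>\<^sup>2" .
      show "0 < M" using 1 p by (metis of_nat_0_less_iff less_le_trans)
    qed
    have lower: "(b ^ K - b ^ (K - 1) * (real K * (b * (1 + \<eta>) - \<beta>))) * Z
      \<le> config_int e (\<lambda>a A x. \<Prod>i<K. cube_avg d (indicator E) (x + (c * norm a) *\<^sub>R (A *v v i)))"
    proof -
      have "c * 2 * ((1 + e) * norm (v i)) \<le> \<tau>" if "i < K" for i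
      proof -
        have "c * 2 * ((1 + e) * norm (v i)) \<le> c * 2 * ((3/2) * (1 + V))"
          using e c V[OF that] V0 by (intro mult_left_mono mult_mono) auto
        also have "\<dots> = c * 3 * (1 + V)" by simp
        finally show ?thesis using c(3) by linarith
      qed
      from config_int_cube_avg_lower[OF e(1) c(1) d(2) gb _ this, of K] show ?thesis
        using K by (simp add: \<tau>(2) \<beta>_def Z_def)
    qed
    also have "\<dots> \<le> 0 + real K * (\<theta> / 2 * Z + 1 / (2 * \<theta>) * (2 * Z / real M + 2 * G * (?o * d / (c * (\<rho> / real M)))))"
      using config_int_telescope[OF e c(1) K(1) M(3) \<rho> \<theta>(1), of v] rot M(3) unfolding zero Z_def G_def by blast
    also have "\<dots> \<le> \<alpha> ^ K / 4 * Z"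
    proof -
      have "2 * Z / real M \<le> \<theta>\<^sup>2 / 2 * Z"
      proof -
        have "4 \<le> real M * \<theta>\<^sup>2" using M(1) \<theta>2(1) by (simp add: pos_divide_le_eq)
        then have "2 / real M \<le> \<theta>\<^sup>2 / 2" using M(3) by (simp add: divide_le_eq mult.commute)
        from mult_right_mono[OF this, of Z] show ?thesis using Z(1) by simp
      qed
      moreover have "2 * G * (?o * d / (c * (\<rho> / real M))) \<le> \<theta>\<^sup>2 / 2 * Z"
      proof -
        have "?o * d \<le> (?o + 1) * (c * \<rho> * w0 * \<theta> ^ 4 / (20 * (?o + 1)))"
          using o d by (intro mult_mono) auto
        also have "\<dots> = c * \<rho> * w0 * \<theta> ^ 4 / 20"
        proof -
          have "z * (y / (20 * z)) = y / 20" if "z \<noteq> 0" for y z :: real using that by simp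
          then show ?thesis using o by (metis add_nonneg_pos less_irrefl zero_less_one)
        qed
        finally have "?o * d / (c * \<rho>) \<le> w0 * \<theta> ^ 4 / 20"
          using c(1) \<rho> by (simp add: field_simps)
        then have "?o * d / (c * \<rho>) * real M \<le> w0 * \<theta> ^ 4 / 20 * (5 / \<theta>\<^sup>2)"
          using M(2) w0 o d(1) c(1) \<rho> by (intro mult_mono) auto
        also have "\<dots> = w0 * \<theta>\<^sup>2 / 4" using \<theta>(1) by (simp add: field_simps power2_eq_square power4_eq_xxxx)
        finally have "2 * G * (?o * d / (c * \<rho>) * real M) \<le> 2 * G * (w0 * \<theta>\<^sup>2 / 4)"
          using G by (intro mult_left_mono) auto
        then show ?thesis by (simp add: Z(2) mult_ac)
      qed
      ultimately have "2 * Z / real M + 2 * G * (?o * d / (c * (\<rho> / real M))) \<le> \<theta>\<^sup>2 * Z" by simp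
      then have "1 / (2 * \<theta>) * (2 * Z / real M + 2 * G * (?o * d / (c * (\<rho> / real M)))) \<le> 1 / (2 * \<theta>) * (\<theta>\<^sup>2 * Z)"
        using \<theta>(1) by (intro mult_left_mono) auto
      also have "\<dots> = \<theta> / 2 * Z" using \<theta>(1) by (simp add: power2_eq_square)
      finally have "\<theta> / 2 * Z + 1 / (2 * \<theta>) * (2 * Z / real M + 2 * G * (?o * d / (c * (\<rho> / real M)))) \<le> \<theta> / 2 * Z + \<theta> / 2 * Z"
        by (rule add_left_mono)
      also have "\<dots> = \<theta> * Z" by simp
      finally have "\<theta> / 2 * Z + 1 / (2 * \<theta>) * (2 * Z / real M + 2 * G * (?o * d / (c * (\<rho> / real M)))) \<le> \<theta> * Z" .
      then have "real K * (\<theta> / 2 * Z + 1 / (2 * \<theta>) * (2 * Z / real M + 2 * G * (?o * d / (c * (\<rho> / real M))))) \<le> real K * (\<theta> * Z)"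
        by (intro mult_left_mono) auto
      also have "\<dots> = \<alpha> ^ K / 4 * Z" using \<theta>(3) by (simp only: mult.assoc[symmetric])
      finally show ?thesis by simp
    qed
    finally have "b ^ K - b ^ (K - 1) * (real K * (b * (1 + \<eta>) - \<beta>)) \<le> \<alpha> ^ K / 4"
      using Z(1) by simp
    moreover have "b ^ (K - 1) * (real K * (b * (1 + \<eta>) - \<beta>)) \<le> b ^ K / 2"
    proof -
      have b0: "0 \<le> b" using \<alpha> E \<eta> by (simp add: b_def \<beta>_def)
      \<comment> \<open>This rewrites \<beta> in terms of \<open>b\<close>: the defect
        \<open>b * (1 + \<eta>) - \<beta>\<close> is at most \<open>2 * \<eta> * b\<close>.\<close>
      have "b * (1 - \<eta>) = \<beta> * (1 - \<eta>\<^sup>2)" by (simp add: b_def power2_eq_square algebra_simps)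
      also have "\<dots> \<le> \<beta>" using \<alpha> E by (simp add: \<beta>_def mult_left_le)
      finally have "b * (1 + \<eta>) - \<beta> \<le> b * (2 * \<eta>)" by (simp add: algebra_simps)
      then have "real K * (b * (1 + \<eta>) - \<beta>) \<le> real K * (b * (2 * \<eta>))" by (intro mult_left_mono) auto
      also have "\<dots> = 2 * b * (real K * \<eta>)" by (simp only: ac_simps)
      also have "\<dots> = b / 2" unfolding \<eta>(2) by simp
      finally have "b ^ (K - 1) * (real K * (b * (1 + \<eta>) - \<beta>)) \<le> b ^ (K - 1) * (b / 2)"
        using b0 by (intro mult_left_mono) auto
      also have "\<dots> = b ^ K / 2" using K(1) by (cases K) auto
      finally show ?thesis .
    qed
    moreover have "\<alpha> ^ K \<le> b ^ K"
    proof (rule power_mono)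
      have "1 * \<beta> \<le> b" unfolding b_def using \<eta> \<alpha> E by (intro mult_right_mono) (auto simp: \<beta>_def)
      then show "\<alpha> \<le> b" using E by (simp add: \<beta>_def)
    qed (use \<alpha> in simp)
    \<comment> \<open>The main term is at least \<open>b ^ K / 2\<close>, hence at least
      \<open>\<alpha> ^ K / 2\<close>, against a total error of
      \<open>\<alpha> ^ K / 4\<close>.\<close>
    ultimately show False using \<alpha>K by linarith
  qed
  show ?thesis
    using \<eta>(1) c1(1,2) c(1,2) main by blast
qed

section \<open>Iterating the increment\<close>

lemma measure_subset_cube_le_1:
  fixes E :: "(real^'n) set"
  assumes "compact E" "E \<subseteq> cbox 0 (vec 1)"
  shows "measure lborel E \<le> 1"
proof -
  have "measure lborel E \<le> measure lborel (cbox 0 (vec 1) :: (real^'n) set)"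
    using assms emeasure_cube_finite[of 0 "vec 1 :: real^'n"]
    by (intro measure_mono_fmeasurable fmeasurableI) (auto intro: borel_closed compact_imp_closed)
  then show ?thesis using measure_cube[of 1, where 'n='n] by simp
qed

text \<open>Here \<open>m\<close> is a budget of remaining steps. Each rescaling multiplies the
  measure by at least \<open>1 + \<eta>\<close>, so the inequality with exponent \<open>m\<close>
  passes to \<open>m - 1\<close>; at 0 it would give a subset of the unit cube of measure above 1.
  Since densities only grow, \<alpha> stays a valid lower bound and \<open>d\<close> never
  changes.\<close>

lemma density_iteration:
  fixes v :: "nat \<Rightarrow> real^'n" and \<alpha> \<eta> c d :: real
  assumes \<eta>: "0 < \<eta>" and c: "0 < c" and d: "0 < d" "d \<le> 1" and \<alpha>: "0 < \<alpha>"
    and step: "\<And>E. compact E \<Longrightarrow> E \<subseteq> cbox 0 (vec 1) \<Longrightarrow> \<alpha> \<le> measure lborel E \<Longrightarrow>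
      (\<exists>x U r. orthogonal_matrix U \<and> c \<le> r \<and> (\<forall>i<K. x + r *\<^sub>R (U *v v i) \<in> E)) \<or>
      (\<exists>y. (1 + \<eta>) * measure lborel E * d ^ CARD('n) \<le> measure lborel (E \<inter> cbox y (y + vec d)))"
    and E: "compact E" "E \<subseteq> cbox 0 (vec 1)" "\<alpha> \<le> measure lborel E" "1 < measure lborel E * (1 + \<eta>) ^ m"
  shows "\<exists>x U r. orthogonal_matrix U \<and> c * d ^ m \<le> r \<and> (\<forall>i<K. x + r *\<^sub>R (U *v v i) \<in> E)"
  using E
proof (induction m arbitrary: E)
  case 0
  then show ?case using measure_subset_cube_le_1[of E] by simp
next
  case (Suc m)
  from step[OF Suc.prems(1-3)] show ?case
  proof
    assume "\<exists>x U r. orthogonal_matrix U \<and> c \<le> r \<and> (\<forall>i<K. x + r *\<^sub>R (U *v v i) \<in> E)"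
    moreover have "c * d ^ Suc m \<le> c" using c d by (intro mult_left_le power_le_one) auto
    ultimately show ?thesis by (meson order_trans)
  next
    assume "\<exists>y. (1 + \<eta>) * measure lborel E * d ^ CARD('n) \<le> measure lborel (E \<inter> cbox y (y + vec d))"
    then obtain y where y: "(1 + \<eta>) * measure lborel E * d ^ CARD('n) \<le> measure lborel (E \<inter> cbox y (y + vec d))" by blast
    \<comment> \<open>The affine map taking the dense small cube onto the unit cube.\<close>
    let ?T = "\<lambda>x. (1 / d) *\<^sub>R x + (- (1 / d)) *\<^sub>R y"
    define E' where "E' = ?T ` (E \<inter> cbox y (y + vec d))"
    have T: "x = y + d *\<^sub>R ?T x" for x using d by (simp add: scaleR_diff_right)
    have cE: "compact (E \<inter> cbox y (y + vec d))" by (intro compact_Int_closed Suc.prems(1) closed_cbox)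
    have cE': "compact E'"
      unfolding E'_def by (intro compact_continuous_image cE continuous_intros)
    have "E' \<subseteq> cbox 0 (vec 1)"
    proof
      fix z assume "z \<in> E'"
      then obtain x where x: "x \<in> cbox y (y + vec d)" "z = ?T x" unfolding E'_def by blast
      have "0 \<le> z $ i \<and> z $ i \<le> 1" for i
      proof -
        have "y $ i \<le> x $ i" "x $ i \<le> y $ i + d" using x(1) by (auto simp: mem_box_cart)
        then show ?thesis using d by (simp add: x(2) field_simps)
      qed
      then show "z \<in> cbox 0 (vec 1)" by (simp add: mem_box_cart)
    qed
    moreover have mE': "(1 + \<eta>) * measure lborel E \<le> measure lborel E'"
    proof -
      have [simp]: "E \<inter> cbox y (y + vec d) \<in> sets borel" "E' \<in> sets borel"
        by (rule borel_closed[OF compact_imp_closed[OF cE]], rule borel_closed[OF compact_imp_closed[OF cE']])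
      have "measure lebesgue E' = \<bar>1 / d\<bar> ^ CARD('n) * measure lebesgue (E \<inter> cbox y (y + vec d))"
        unfolding E'_def by (subst measure_lebesgue_affine) simp
      then have "measure lborel E' = measure lborel (E \<inter> cbox y (y + vec d)) / d ^ CARD('n)"
        using d by (simp add: power_one_over)
      then show ?thesis using y d by (simp add: pos_le_divide_eq)
    qed
    moreover have "\<alpha> \<le> measure lborel E'"
    proof -
      have "1 * measure lborel E \<le> (1 + \<eta>) * measure lborel E" using \<eta> by (intro mult_right_mono) auto
      then show ?thesis using mE' Suc.prems(3) by linarith
    qed
    moreover have "1 < measure lborel E' * (1 + \<eta>) ^ m"
    proof -
      have "1 < (1 + \<eta>) * measure lborel E * (1 + \<eta>) ^ m" using Suc.prems(4) by (simp add: mult_ac)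
      also have "\<dots> \<le> measure lborel E' * (1 + \<eta>) ^ m" using mE' \<eta> by (intro mult_right_mono) auto
      finally show ?thesis .
    qed
    ultimately obtain x U r where U: "orthogonal_matrix U" and r: "c * d ^ m \<le> r"
      and x: "\<forall>i<K. x + r *\<^sub>R (U *v v i) \<in> E'" using Suc.IH[OF cE'] by blast
    \<comment> \<open>Undoing the rescaling keeps the orthogonal matrix and multiplies the dilation
      by \<open>d\<close>.\<close>
    have "(y + d *\<^sub>R x) + (d * r) *\<^sub>R (U *v v i) \<in> E" if "i < K" for i
    proof -
      obtain p where p: "p \<in> E" "x + r *\<^sub>R (U *v v i) = ?T p" using x \<open>i < K\<close> unfolding E'_def by blast
      have "(y + d *\<^sub>R x) + (d * r) *\<^sub>R (U *v v i) = y + d *\<^sub>R (x + r *\<^sub>R (U *v v i))"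
        by (simp add: scaleR_add_right)
      also have "\<dots> = p" unfolding p(2) using T[of p] by simp
      finally show ?thesis using p(1) by simp
    qed
    moreover have "c * d ^ Suc m \<le> d * r" using mult_left_mono[OF r, of d] d by (simp add: mult_ac)
    ultimately show ?thesis using U by blast
  qed
qed

text \<open>Otherwise \<open>v j\<close> would lie in the affine hull of the remaining vertices,
  which is \<open>v i0\<close> plus the span of their differences from \<open>v i0\<close>.
  Injectivity ensures that dropping the index \<open>j\<close> drops the point
  \<open>v j\<close>.\<close>

lemma independent_differences:
  fixes v :: "nat \<Rightarrow> 'a::euclidean_space"
  assumes inj: "inj_on v {..<K}" and aff: "\<not> affine_dependent (v ` {..<K})"
    and j: "j < K" "i0 < K" "i0 \<noteq> j"
  shows "v j - v i0 \<notin> span ((\<lambda>i. v i - v i0) ` ({..<K} - {j}))"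
proof
  let ?S = "v ` ({..<K} - {j})"
  assume *: "v j - v i0 \<in> span ((\<lambda>i. v i - v i0) ` ({..<K} - {j}))"
  have "v i0 \<in> affine hull ?S" using j by (intro hull_inc) auto
  from affine_hull_span_gen[OF this]
  have "affine hull ?S = (\<lambda>x. v i0 + x) ` span ((\<lambda>i. v i - v i0) ` ({..<K} - {j}))"
    by (simp add: image_image)
  moreover have "v j = v i0 + (v j - v i0)" by simp
  ultimately have "v j \<in> affine hull ?S" using * by (metis imageI)
  also have "?S = v ` {..<K} - {v j}" using inj j by (auto simp: inj_on_def)
  finally show False using aff j unfolding affine_dependent_def by blast
qed

text \<open>Both the number of steps and the logarithmic cost of a step are linear in
  \<open>1 + L\<close>, so their product is quadratic. Allowing \<open>L'\<close> up to
  \<open>1 + L\<close> leaves room for halving the density.\<close>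

lemma exp_bound_of_power:
  fixes c c1 h L L' :: real
  assumes c: "0 < c" "c \<le> 1" and c1: "0 < c1" "c1 \<le> 1" and h: "0 < h" and L: "0 \<le> L" "0 \<le> L'" "L' \<le> 1 + L"
    and m: "real m \<le> L' / h + 2"
  shows "exp (- (- ln c + (1 / h + 2) * (- ln c1 + real k) + 1) * (1 + L)\<^sup>2) \<le> c * (c1 * exp (- L') ^ k) ^ m"
proof -
  let ?s = "1 + L"
  have s: "1 \<le> ?s" "1 \<le> ?s\<^sup>2" using L by (auto simp: one_le_power)
  have lc: "0 \<le> - ln c" "0 \<le> - ln c1" using c c1 by auto
  have "c * (c1 * exp (- L') ^ k) ^ m = exp (ln c + real m * (ln c1 - real k * L'))"
  proof -
    have "exp (ln c1 - real k * L') = exp (ln c1 + real k * (- L'))" by simp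
    also have "\<dots> = c1 * exp (- L') ^ k" using c1 by (simp only: exp_add exp_of_nat_mult exp_ln)
    finally show ?thesis using c by (simp only: exp_add exp_of_nat_mult exp_ln)
  qed
  moreover have "- (- ln c + (1 / h + 2) * (- ln c1 + real k) + 1) * ?s\<^sup>2 \<le> ln c + real m * (ln c1 - real k * L')"
  proof -
    have "L' / h \<le> ?s / h" using h L by (intro divide_right_mono) auto
    then have m': "real m \<le> (1 / h + 2) * ?s" using m s by (simp add: algebra_simps)
    have "real k * L' \<le> real k * ?s" using L by (intro mult_left_mono) auto
    moreover have "- ln c1 * 1 \<le> - ln c1 * ?s" using lc s by (intro mult_left_mono) auto
    ultimately have 1: "- ln c1 + real k * L' \<le> (- ln c1 + real k) * ?s" by (simp add: algebra_simps)
    have "real m * (- ln c1 + real k * L') \<le> ((1 / h + 2) * ?s) * ((- ln c1 + real k) * ?s)"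
      using m' 1 lc L h by (intro mult_mono add_nonneg_nonneg mult_nonneg_nonneg) auto
    also have "\<dots> = (1 / h + 2) * (- ln c1 + real k) * ?s\<^sup>2" by (simp add: power2_eq_square mult_ac)
    finally have 2: "real m * (- ln c1 + real k * L') \<le> (1 / h + 2) * (- ln c1 + real k) * ?s\<^sup>2" .
    have "- ln c * 1 \<le> - ln c * ?s\<^sup>2" using lc s by (intro mult_left_mono) auto
    moreover have "- (a + b + 1) * S \<le> - a + - w" if "a * 1 \<le> a * S" "w \<le> b * S" "1 \<le> S" for a b S w :: real
      using that by (simp add: algebra_simps)
    ultimately have "- (- ln c + (1 / h + 2) * (- ln c1 + real k) + 1) * ?s\<^sup>2
        \<le> - (- ln c) + - (real m * (- ln c1 + real k * L'))"
      using 2 s(2) by blast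
    then show ?thesis by (simp add: algebra_simps)
  qed
  ultimately show ?thesis by simp
qed

section \<open>Assembly for measurable sets\<close>

theorem corollary1p3:
  fixes K :: nat and \<Delta> :: "(real ^ 'n) set"
  assumes "K \<ge> 3"
    and "CARD('n) \<ge> 4 * K + 4"
    and "\<Delta> \<subseteq> integer_points"
    and "nondegenerate_simplex_vertices K \<Delta>"
  shows "\<exists>C::real. C > 0 \<and>
    (\<forall>(\<alpha>::real) E. \<alpha> > 0 \<longrightarrow> E \<in> sets lebesgue \<longrightarrow> E \<subseteq> unit_cube \<longrightarrow> measure lebesgue E \<ge> \<alpha> \<longrightarrow>
      (\<exists>(x :: real ^ 'n) (U :: real ^ 'n ^ 'n) (r :: real).
         orthogonal_matrix U \<and>
         r \<ge> exp (- C * (1 + ln (1 / \<alpha>))\<^sup>2) \<and>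
         similar_copy x r U \<Delta> \<subseteq> E))"
proof -
  have \<Delta>: "finite \<Delta>" "card \<Delta> = K" "\<not> affine_dependent \<Delta>"
    using assms(4) by (auto simp: nondegenerate_simplex_vertices_def)
  obtain v where "bij_betw v {0..<K} \<Delta>" using ex_bij_betw_nat_finite[OF \<Delta>(1)] \<Delta>(2) by blast
  then have v: "inj_on v {..<K}" "v ` {..<K} = \<Delta>" by (auto simp: bij_betw_def lessThan_atLeast0)
  have K: "2 \<le> K" "K < CARD('n)" using assms(1,2) by auto
  have "v j - v i0 \<notin> span ((\<lambda>i. v i - v i0) ` ({..<K} - {j}))" if "j < K" "i0 < K" "i0 \<noteq> j" for j i0
    by (rule independent_differences[OF v(1) _ that]) (use \<Delta>(3) v(2) in simp)
  from density_dichotomy[OF K this]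
  obtain \<eta> c1 c where \<eta>: "0 < \<eta>" and c1: "0 < c1" "c1 \<le> 1" and c: "0 < c" "c \<le> 1"
    and dich: "\<And>\<alpha> E. 0 < \<alpha> \<Longrightarrow> \<alpha> \<le> 1 \<Longrightarrow> compact E \<Longrightarrow> E \<subseteq> cbox 0 (vec 1) \<Longrightarrow> \<alpha> \<le> measure lborel E \<Longrightarrow>
      (\<exists>x U r. orthogonal_matrix U \<and> c \<le> r \<and> (\<forall>i<K. x + r *\<^sub>R (U *v v i) \<in> E)) \<or>
      (\<exists>y. (1 + \<eta>) * measure lborel E * (c1 * \<alpha> ^ (4 * K)) ^ CARD('n)
        \<le> measure lborel (E \<inter> cbox y (y + vec (c1 * \<alpha> ^ (4 * K)))))"
    by blast
  define h where "h = ln (1 + \<eta>)"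
  have h: "0 < h" using \<eta> by (simp add: h_def)
  \<comment> \<open>The summand 1 makes \<open>C\<close> positive even if all the others
    vanish.\<close>
  define C where "C = - ln c + (1 / h + 2) * (- ln c1 + real (4 * K)) + 1"
  have "0 \<le> - ln c" "0 \<le> (1 / h + 2) * (- ln c1 + real (4 * K))"
  proof -
    show "0 \<le> - ln c" using c by simp
    have "ln c1 \<le> 0" using c1 by simp
    then show "0 \<le> (1 / h + 2) * (- ln c1 + real (4 * K))" using h by (intro mult_nonneg_nonneg) auto
  qed
  then have C: "C > 0" unfolding C_def by linarith
  have main: "\<exists>x U r. orthogonal_matrix U \<and> r \<ge> exp (- C * (1 + ln (1 / \<alpha>))\<^sup>2) \<and> similar_copy x r U \<Delta> \<subseteq> E"
    if \<alpha>: "\<alpha> > 0" and E: "E \<in> sets lebesgue" "E \<subseteq> unit_cube" "measure lebesgue E \<ge> \<alpha>" for \<alpha> and E :: "(real^'n) set"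
  proof -
    have cube: "unit_cube = (cbox 0 (vec 1) :: (real^'n) set)" by (auto simp: unit_cube_def mem_box_cart)
    have lE: "E \<in> lmeasurable"
      using bounded_set_imp_lmeasurable[of E] E bounded_subset[OF bounded_cbox, of E 0 "vec 1"] by (simp add: cube)
    \<comment> \<open>Inner regularity gives up half of the density to gain compactness, on which
      the passage from near copies to exact ones depends.\<close>
    obtain T where T: "closed T" "T \<subseteq> E" "E - T \<in> lmeasurable" "emeasure lebesgue (E - T) < ennreal (\<alpha> / 2)"
      using sets_lebesgue_inner_closed[OF E(1), of "\<alpha> / 2"] \<alpha> by auto
    have "bounded T" using T(2) E(2) bounded_subset[OF bounded_cbox] by (metis cube order_trans)
    then have cT: "compact T" using T(1) by (simp add: compact_eq_bounded_closed)
    have Tc: "T \<subseteq> cbox 0 (vec 1)" using T(2) E(2) cube by auto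
    define \<alpha>' where "\<alpha>' = \<alpha> / 2"
    have mT: "\<alpha>' \<le> measure lborel T"
    proof -
      have lT: "T \<in> lmeasurable" using cT by (rule lmeasurable_compact)
      have "measure lebesgue (E - T) < \<alpha> / 2"
        using T(3,4) \<alpha> by (simp add: emeasure_eq_measure2 ennreal_less_iff)
      moreover have "measure lebesgue E \<le> measure lebesgue T + measure lebesgue (E - T)"
        using measure_Un_le[of T lebesgue "E - T"] lT T by (simp add: Un_absorb1 fmeasurableD)
      ultimately have "\<alpha>' \<le> measure lebesgue T" using E(3) unfolding \<alpha>'_def by linarith
      then show ?thesis using T(1) by (simp add: borel_closed)
    qed
    have \<alpha>1: "\<alpha> \<le> 1"
    proof -
      have "measure lebesgue E \<le> measure lebesgue (cbox 0 (vec 1) :: (real^'n) set)"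
        using E lE by (intro measure_mono_fmeasurable) (auto simp: cube)
      then show ?thesis using measure_cube[of 1, where 'n='n] E(3) by simp
    qed
    have \<alpha>': "0 < \<alpha>'" "\<alpha>' \<le> 1" using \<alpha> \<alpha>1 by (auto simp: \<alpha>'_def)
    define L where "L = ln (1 / \<alpha>)"
    define L' where "L' = ln (1 / \<alpha>')"
    have L: "0 \<le> L" "0 \<le> L'" "L' \<le> 1 + L" "exp (- L') = \<alpha>'"
    proof -
      show "0 \<le> L" "0 \<le> L'" using \<alpha> \<alpha>1 \<alpha>' by (auto simp: L_def L'_def)
      have "L' = ln 2 + L" using \<alpha> by (simp add: L_def L'_def \<alpha>'_def ln_div)
      \<comment> \<open>Halving the density adds \<open>ln 2\<close> to the logarithm, and
        \<open>ln 2\<close> is at most 1.\<close>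
      then show "L' \<le> 1 + L" using ln_le_minus_one[of 2] by simp
      show "exp (- L') = \<alpha>'" using \<alpha>' by (simp add: L'_def ln_div)
    qed
    \<comment> \<open>The successor makes \<open>L' / h < real m\<close> strict, as the iteration
      needs the final density to exceed 1.\<close>
    define m where "m = Suc (nat \<lceil>L' / h\<rceil>)"
    have q: "0 \<le> L' / h" using L h by simp
    have m: "L' / h < real m" "real m \<le> L' / h + 2" unfolding m_def using q by linarith+
    define d where "d = c1 * \<alpha>' ^ (4 * K)"
    have d: "0 < d" "d \<le> 1" using c1 \<alpha>' by (auto simp: d_def intro!: mult_le_one power_le_one)
    have big: "1 < measure lborel T * (1 + \<eta>) ^ m"
    proof -
      have "L' < real m * h" using m(1) h by (simp add: pos_divide_less_eq)
      then have "exp L' < exp (real m * h)" by simp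
      also have "\<dots> = (1 + \<eta>) ^ m" using \<eta> by (simp add: h_def exp_of_nat_mult)
      finally have "\<alpha>' * exp L' < \<alpha>' * (1 + \<eta>) ^ m" using \<alpha>' by simp
      moreover have "\<alpha>' * exp L' = 1" unfolding L(4)[symmetric] by (simp add: exp_minus)
      moreover have "\<alpha>' * (1 + \<eta>) ^ m \<le> measure lborel T * (1 + \<eta>) ^ m" using mT \<eta> by (intro mult_right_mono) auto
      ultimately show ?thesis by linarith
    qed
    have "\<exists>x U r. orthogonal_matrix U \<and> c * d ^ m \<le> r \<and> (\<forall>i<K. x + r *\<^sub>R (U *v v i) \<in> T)"
      by (rule density_iteration[OF \<eta> c(1) d \<alpha>'(1) _ cT Tc mT big])
         (use dich[OF \<alpha>'] in \<open>simp add: d_def\<close>)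
    then obtain x U r where xUr: "orthogonal_matrix U" "c * d ^ m \<le> r" "\<forall>i<K. x + r *\<^sub>R (U *v v i) \<in> T" by blast
    have "exp (- C * (1 + L)\<^sup>2) \<le> c * d ^ m"
      using exp_bound_of_power[OF c c1 h L(1-3) m(2), of "4 * K"] unfolding C_def d_def L(4) .
    then have "r \<ge> exp (- C * (1 + ln (1 / \<alpha>))\<^sup>2)" using xUr(2) unfolding L_def by linarith
    moreover have "similar_copy x r U \<Delta> \<subseteq> E"
      using xUr(3) T(2) unfolding similar_copy_def v(2)[symmetric] by auto
    ultimately show ?thesis using xUr(1) by blast
  qed
  show ?thesis using C main by blast
qed

end
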